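(* There exists a subset $M$ of $\mathbb{I}$ which is not $\sigma$-compact and such that: (1) $|M|=\mathfrak{d}$; (2) $M$ satisfies $\mathsf{S}_1(\Gamma,\mathcal{O})$, but $M\setminus Q$ does not satisfy $\mathsf{U}_{fin}(\Gamma,\mathcal{O})$; (3) if NCF holds, then $M$ satisfies $\mathsf{U}_{fin}(\Gamma,\Omega)$; (4) if $\mathfrak{b}=\mathfrak{d}$ or $\mathrm{add}(\mathcal{D}_{fin})=\mathfrak{d}$, then $M$ satisfies $\mathsf{S}_{fin}(\Omega,\Omega)$.
   Context: $\overline{\mathbb{N}}=\mathbb{N}\cup\{\infty\}$ is the one-point compactification of $\mathbb{N}$; $\mathbb{I}\subseteq\overline{\mathbb{N}}^{\mathbb{N}}$ (product topology) is the set of nondecreasing $f$ with $f(n)<f(n+1)$ whenever $f(n)<\infty$ (homeomorphic to the Cantor space). For finite strictly increasing $s\subseteq\mathbb{N}$, $q_s(k)=s(k)$ for $k<|s|$, $q_s(k)=\infty$ otherwise; $Q=\{q_s\}$. $\mathfrak{b},\mathfrak{d}$: bounding and dominating numbers. A set $F\subseteq\mathbb{N}^{\mathbb{N}}$ is finitely-dominating if for each $g\in\mathbb{N}^{\mathbb{N}}$ there are $k$ and $f_1,\dots,f_k\in F$ with $g(n)\le\max\{f_1(n),\dots,f_k(n)\}$ for all but finitely many $n$. $\mathcal{D}_{fin}$ is the collection of sets of increasing elements of $\mathbb{N}^{\mathbb{N}}$ which are not finitely-dominating, and $\mathrm{add}(\mathcal{D}_{fin})=\min\{|\mathcal{F}|:\mathcal{F}\subseteq\mathcal{D}_{fin},\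 \bigcup\mathcal{F}\notin\mathcal{D}_{fin}\}$. NCF (Near Coherence of Filters) is the statement that for any two nonprincipal ultrafilters $\mathcal{U},\mathcal{V}$ on $\mathbb{N}$ there is a finite-to-one $f:\mathbb{N}\to\mathbb{N}$ with $f(\mathcal{U})=f(\mathcal{V})$. For a space $X$: $\mathcal{O}$ = countable open covers; $\Omega$ = countable open $\omega$-covers (no member contains $X$, each finite subset of $X$ lies in some member); $\Gamma$ = countable open $\gamma$-covers (infinite, no member contains $X$, each point in all but finitely many members). $\mathsf{S}_1(\mathscr{A},\mathscr{B})$: for each sequence $(\mathcal{U}_n)$ in $\mathscr{A}$ there exist $U_n\in\mathcal{U}_n$ with $\{U_n\}\in\mathscr{B}$. $\mathsf{S}_{fin}(\mathscr{A},\mathscr{B})$: there exist finite $\mathcal{F}_n\subseteq\mathcal{U}_n$ with $\bigcup_n\mathcal{F}_n\in\mathscr{B}$. $\mathsf{U}_{fin}(\mathscr{A},\mathscr{B})$: for each sequence $(\mathcal{U}_n)$ in $\mathscr{A}$ none containing a finite subcover, there exist finite $\mathcal{F}_n\subseteq\mathcal{U}_n$ with $\{\bigcup\mathcal{F}_n:n\in\mathbb{N}\}\in\mathscr{B}$. *)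

theory Defs
  imports "HOL-Analysis.Analysis"
begin

unbundle cardinal_syntax

text \<open>The library equips \<^typ>\<open>enat\<close> with its order topology, which is the topology of the one-point
  compactification of the discrete space of natural numbers, and function types with the product
  topology.\<close>

definition incr_space :: "(nat \<Rightarrow> enat) set" where
  "incr_space = {f. mono f \<and> (\<forall>n. f n < \<infinity> \<longrightarrow> f n < f (Suc n))}"

text \<open>A finite strictly increasing sequence is identified with its finite set of values.\<close>

definition q_seq :: "nat set \<Rightarrow> nat \<Rightarrow> enat" where
  "q_seq s k = (if k < card s then enat (sorted_list_of_set s ! k) else \<infinity>)"

definition Q :: "(nat \<Rightarrow> enat) set" where
  "Q = q_seq ` {s. finite s}"

definition sigma_compact :: "'a::topological_space set \<Rightarrow> bool" where
  "sigma_compact S \<longleftrightarrow> (\<exists>K. countable K \<and> (\<forall>C\<in>K. compact C) \<and> \<Union>K = S)"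

text \<open>The least cardinality of a member of a nonempty family of sets; unspecified if the family is
  empty.\<close>

definition min_card :: "'a set set \<Rightarrow> 'a rel" where
  "min_card \<S> = (SOME r. (\<exists>A\<in>\<S>. r = |A| ) \<and> (\<forall>A\<in>\<S>. r \<le>o |A| ))"

lemma min_card_works:
  assumes "\<S> \<noteq> {}"
  shows "(\<exists>A\<in>\<S>. min_card \<S> = |A| ) \<and> (\<forall>A\<in>\<S>. min_card \<S> \<le>o |A| )"
proof -
  have "\<exists>r\<in>card_of ` \<S>. \<forall>r'\<in>card_of ` \<S>. r \<le>o r'"
    by (rule exists_minim_Well_order) (use assms card_of_Well_order in auto)
  then have "\<exists>r. (\<exists>A\<in>\<S>. r = |A| ) \<and> (\<forall>A\<in>\<S>. r \<le>o |A| )"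
    by blast
  then show ?thesis
    unfolding min_card_def by (rule someI_ex)
qed

definition le_star :: "(nat \<Rightarrow> nat) \<Rightarrow> (nat \<Rightarrow> nat) \<Rightarrow> bool"  (infix "\<le>\<^sup>*" 50) where
  "f \<le>\<^sup>* g \<longleftrightarrow> (\<forall>\<^sub>F n in sequentially. f n \<le> g n)"

definition bounding_number :: "(nat \<Rightarrow> nat) rel" where
  "bounding_number = min_card {B. \<nexists>g. \<forall>f\<in>B. f \<le>\<^sup>* g}"

definition dominating_number :: "(nat \<Rightarrow> nat) rel" where
  "dominating_number = min_card {D. \<forall>g. \<exists>f\<in>D. g \<le>\<^sup>* f}"

definition finitely_dominating :: "(nat \<Rightarrow> nat) set \<Rightarrow> bool" where
  "finitely_dominating F \<longleftrightarrow>
     (\<forall>g. \<exists>G\<subseteq>F. finite G \<and> G \<noteq> {} \<and> g \<le>\<^sup>* (\<lambda>n. Max {f n | f. f \<in> G}))"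

definition D_fin :: "(nat \<Rightarrow> nat) set set" where
  "D_fin = {F. (\<forall>f\<in>F. strict_mono f) \<and> \<not> finitely_dominating F}"

definition additivity :: "'a set set \<Rightarrow> 'a set rel" where
  "additivity \<I> = min_card {\<F>. \<F> \<subseteq> \<I> \<and> \<Union>\<F> \<notin> \<I>}"

definition ultrafilter :: "'a filter \<Rightarrow> bool" where
  "ultrafilter \<U> \<longleftrightarrow> \<U> \<noteq> bot \<and> (\<forall>P. eventually P \<U> \<or> eventually (\<lambda>x. \<not> P x) \<U>)"

definition nonprincipal :: "'a filter \<Rightarrow> bool" where
  "nonprincipal \<U> \<longleftrightarrow> (\<nexists>A. \<U> = principal A)"

definition NCF :: bool where
  "NCF \<longleftrightarrow> (\<forall>\<U> \<V> :: nat filter.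
     ultrafilter \<U> \<and> nonprincipal \<U> \<and> ultrafilter \<V> \<and> nonprincipal \<V> \<longrightarrow>
     (\<exists>f :: nat \<Rightarrow> nat. (\<forall>n. finite (f -` {n})) \<and> filtermap f \<U> = filtermap f \<V>))"

definition open_covers :: "'a topology \<Rightarrow> 'a set set set" where
  "open_covers X = {\<U>. countable \<U> \<and> (\<forall>U\<in>\<U>. openin X U) \<and> \<Union>\<U> = topspace X}"

definition omega_covers :: "'a topology \<Rightarrow> 'a set set set" where
  "omega_covers X = {\<U> \<in> open_covers X. (\<forall>U\<in>\<U>. \<not> topspace X \<subseteq> U) \<and>
     (\<forall>F\<subseteq>topspace X. finite F \<longrightarrow> (\<exists>U\<in>\<U>. F \<subseteq> U))}"

definition gamma_covers :: "'a topology \<Rightarrow> 'a set set set" where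
  "gamma_covers X = {\<U> \<in> open_covers X. infinite \<U> \<and> (\<forall>U\<in>\<U>. \<not> topspace X \<subseteq> U) \<and>
     (\<forall>x\<in>topspace X. finite {U \<in> \<U>. x \<notin> U})}"

definition S_1 ::
  "('a topology \<Rightarrow> 'a set set set) \<Rightarrow> ('a topology \<Rightarrow> 'a set set set) \<Rightarrow> 'a topology \<Rightarrow> bool" where
  "S_1 \<A> \<B> X \<longleftrightarrow> (\<forall>\<U> :: nat \<Rightarrow> 'a set set. (\<forall>n. \<U> n \<in> \<A> X) \<longrightarrow>
     (\<exists>U. (\<forall>n. U n \<in> \<U> n) \<and> {U n | n. True} \<in> \<B> X))"

definition S_fin ::
  "('a topology \<Rightarrow> 'a set set set) \<Rightarrow> ('a topology \<Rightarrow> 'a set set set) \<Rightarrow> 'a topology \<Rightarrow> bool" where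
  "S_fin \<A> \<B> X \<longleftrightarrow> (\<forall>\<U> :: nat \<Rightarrow> 'a set set. (\<forall>n. \<U> n \<in> \<A> X) \<longrightarrow>
     (\<exists>\<F>. (\<forall>n. finite (\<F> n) \<and> \<F> n \<subseteq> \<U> n) \<and> (\<Union>n. \<F> n) \<in> \<B> X))"

definition U_fin ::
  "('a topology \<Rightarrow> 'a set set set) \<Rightarrow> ('a topology \<Rightarrow> 'a set set set) \<Rightarrow> 'a topology \<Rightarrow> bool" where
  "U_fin \<A> \<B> X \<longleftrightarrow> (\<forall>\<U> :: nat \<Rightarrow> 'a set set.
     (\<forall>n. \<U> n \<in> \<A> X \<and> (\<nexists>\<F>. finite \<F> \<and> \<F> \<subseteq> \<U> n \<and> topspace X \<subseteq> \<Union>\<F>)) \<longrightarrow>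
     (\<exists>\<F>. (\<forall>n. finite (\<F> n) \<and> \<F> n \<subseteq> \<U> n) \<and> {\<Union>(\<F> n) | n. True} \<in> \<B> X))"

end

theory Submission
  imports Defs
begin

text \<open>The set is \<open>M = Q \<union> R\<close>, where \<open>R\<close> consists of \<open>\<dd>\<close> many strictly increasing sequences and
  dominates everywhere. A neighbourhood of \<open>Q\<close> determines a function \<open>H\<close> such that it contains every
  sequence whose range misses \<open>(n, H n]\<close> for some \<open>n\<close>. Enumerating a dominating family in type \<open>\<dd>\<close>
  and letting the \<open>\<alpha>\<close>-th sequence have such gaps for all functions of index at most \<open>\<alpha>\<close>, every
  neighbourhood of \<open>Q\<close> misses fewer than \<open>\<dd>\<close> points of \<open>M\<close>; this yields \<open>S\<^sub>1(\<Gamma>, O)\<close>, and it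
  excludes \<open>\<sigma>\<close>-compactness, because an uncountable compact subset of \<open>M\<close> would contain a bounded
  Cantor set of sequences.

  Suppose that, for some free ultrafilter \<open>U\<close>, every family of fewer than \<open>\<dd>\<close> functions is bounded
  modulo \<open>U\<close>. Then the gaps can be required to occur at \<open>U\<close>-many \<open>n\<close>, so that finitely many
  sequences have common gaps; this gives \<open>S\<^sub>f\<^sub>i\<^sub>n(\<Omega>, \<Omega>)\<close>, hence \<open>U\<^sub>f\<^sub>i\<^sub>n(\<Gamma>, \<Omega>)\<close>. Each of
  \<open>\<bb> = \<dd>\<close>, \<open>add(D\<^sub>f\<^sub>i\<^sub>n) = \<dd>\<close> and NCF provides such a \<open>U\<close>.\<close>

section \<open>Sets of fewer than \<open>\<dd>\<close> elements\<close>

definition small :: "'a set \<Rightarrow> bool" where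
  "small A \<longleftrightarrow> |A| <o dominating_number"

lemma dominating_family_exists:
  obtains D where "dominating_number = |D|" "\<forall>g. \<exists>f\<in>D. g \<le>\<^sup>* f"
proof -
  have "\<forall>g. \<exists>f\<in>UNIV. g \<le>\<^sup>* f"
    unfolding le_star_def by (metis (no_types) UNIV_I always_eventually order_refl)
  then have "{D. \<forall>g. \<exists>f\<in>D. g \<le>\<^sup>* f} \<noteq> {}"
    by blast
  from min_card_works[OF this] show ?thesis
    unfolding dominating_number_def[symmetric] using that by blast
qed

lemma dominating_number_le:
  assumes "\<And>g. \<exists>f\<in>D. g \<le>\<^sup>* f"
  shows "dominating_number \<le>o |D|"
  using min_card_works[of "{D. \<forall>g. \<exists>f\<in>D. g \<le>\<^sup>* f}"] assms
  unfolding dominating_number_def by blast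

lemma Card_order_dominating_number: "Card_order dominating_number"
  by (metis card_of_Card_order dominating_family_exists)

lemma small_not_dominating:
  assumes "small C"
  obtains g where "\<And>c. c \<in> C \<Longrightarrow> \<not> g \<le>\<^sup>* c"
  using dominating_number_le[of C] assms not_ordLess_ordLeq unfolding small_def by blast

lemma small_or_large: "small A \<or> dominating_number \<le>o |A|"
  unfolding small_def
  using Card_order_dominating_number card_of_Well_order card_order_on_well_order_on
    ordLess_or_ordLeq by blast

text \<open>Diagonal argument: along an enumeration \<open>e\<close> of \<open>D\<close>, the
  successor of the sum of the first members exceeds \<open>e k\<close> at every argument from
  \<open>k\<close> on.\<close>

lemma countable_not_dominating:
  assumes "countable D"
  shows "\<exists>g. \<forall>f\<in>D. \<not> g \<le>\<^sup>* f"
proof (cases "D = {}")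
  case False
  define e where "e = from_nat_into D"
  define g where "g n = Suc (\<Sum>k\<le>n. e k n)" for n
  have "\<not> g \<le>\<^sup>* f" if "f \<in> D" for f
  proof
    assume "g \<le>\<^sup>* f"
    obtain k where k: "f = e k"
      using \<open>f \<in> D\<close> assms from_nat_into_surj unfolding e_def by metis
    obtain N where N: "\<And>n. n \<ge> N \<Longrightarrow> g n \<le> f n"
      using \<open>g \<le>\<^sup>* f\<close> unfolding le_star_def eventually_sequentially by blast
    have "e k (max N k) \<le> (\<Sum>j\<le>max N k. e j (max N k))"
      by (rule member_le_sum) auto
    then show False
      using N[of "max N k"] k by (simp add: g_def)
  qed
  then show ?thesis by blast
qed auto

lemma countable_imp_small:
  assumes "countable A"
  shows "small A"
proof -
  obtain D where D: "dominating_number = |D|" "\<forall>g. \<exists>f\<in>D. g \<le>\<^sup>* f"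
    by (rule dominating_family_exists)
  have "\<not> |D| \<le>o |A|"
    using countable_not_dominating[of D] D(2) assms
    by (metis card_of_ordLeq countable_image_inj_on countable_subset)
  then show ?thesis
    using small_or_large[of A] D(1) by simp
qed

lemma Cinfinite_dominating_number: "Cinfinite dominating_number"
proof -
  have "|UNIV :: nat set| <o dominating_number"
    using countable_imp_small[of "UNIV :: nat set"] by (simp add: small_def)
  then have "cinfinite dominating_number"
    by (metis cinfinite_mono card_of_nat natLeq_cinfinite ordIso_ordLess_trans ordIso_symmetric
        ordLess_imp_ordLeq)
  then show ?thesis
    using Card_order_dominating_number by simp
qed

lemma small_subset: "small B \<Longrightarrow> A \<subseteq> B \<Longrightarrow> small A"
  unfolding small_def using card_of_mono1 ordLeq_ordLess_trans by blast

lemma small_image: "small A \<Longrightarrow> small (f ` A)"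
  unfolding small_def using card_of_image ordLeq_ordLess_trans by blast

lemma small_Un: "small A \<Longrightarrow> small B \<Longrightarrow> small (A \<union> B)"
  unfolding small_def by (rule Un_Cinfinite_bound_strict[OF _ _ Cinfinite_dominating_number])

text \<open>A small set may be finite, while the cardinal bounds for products and unions ask for an
  infinite set. Adjoining a disjoint copy of the naturals repairs this and stays below \<dd>, which
  is uncountable.\<close>

lemma small_infinite_hull:
  fixes A :: "'a set"
  assumes "small A"
  obtains B :: "(nat + 'a) set" where "small B" "infinite B" "|A| \<le>o |B|" "|UNIV::nat set| \<le>o |B|"
proof
  let ?B = "Inl ` (UNIV :: nat set) \<union> Inr ` A"
  show "small ?B"
    using assms countable_imp_small[of "UNIV :: nat set"] by (intro small_Un small_image) auto
  show "infinite ?B"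
    by (simp add: finite_image_iff)
  show "|A| \<le>o |?B|"
    by (rule card_of_ordLeqI[of Inr]) auto
  show "|UNIV :: nat set| \<le>o |?B|"
    by (rule card_of_ordLeqI[of Inl]) auto
qed

lemma small_Times:
  fixes A :: "'a set" and B :: "'b set"
  assumes "small A" "small B"
  shows "small (A \<times> B)"
proof -
  \<comment> \<open>A single infinite small set bounds both factors, hence also their
    product.\<close>
  have "small (Inl ` A \<union> Inr ` B)"
    using assms by (intro small_Un small_image)
  then obtain C :: "(nat + 'a + 'b) set" where C: "small C" "infinite C" "|Inl ` A \<union> Inr ` B| \<le>o |C|"
    using small_infinite_hull by metis
  have "|A| \<le>o |Inl ` A \<union> Inr ` B|" "|B| \<le>o |Inl ` A \<union> Inr ` B|"
    by (auto intro: card_of_ordLeqI[of Inl] card_of_ordLeqI[of Inr])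
  then have "|A| \<le>o |C|" "|B| \<le>o |C|"
    using C(3) ordLeq_transitive by blast+
  then have "|A \<times> B| \<le>o |C|"
    using C(2) by (auto intro: card_of_Sigma_ordLeq_infinite)
  then show ?thesis
    using C(1) ordLeq_ordLess_trans unfolding small_def by blast
qed

text \<open>Finite subsets are sets of entries of lists. An infinite bound \<open>B\<close> for
  \<open>A\<close> also bounds the lists of each length, and then their countable union.\<close>

lemma small_Fpow:
  fixes A :: "'a set"
  assumes "small A"
  shows "small (Fpow A)"
proof -
  obtain B :: "(nat + 'a) set" where B: "small B" "infinite B" "|A| \<le>o |B|" "|UNIV::nat set| \<le>o |B|"
    using small_infinite_hull assms by metis
  have lists: "|{xs \<in> lists A. length xs = n}| \<le>o |B|" for n
  proof (induction n)
    case 0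
    have "{xs \<in> lists A. length xs = 0} = {[]}" by auto
    then show ?case using B(2) by (simp add: card_of_singl_ordLeq infinite_imp_nonempty)
  next
    case (Suc n)
    have "{xs \<in> lists A. length xs = Suc n} \<subseteq> (\<lambda>(x, xs). x # xs) ` (A \<times> {xs \<in> lists A. length xs = n})"
      by (force simp: length_Suc_conv image_iff)
    then have "|{xs \<in> lists A. length xs = Suc n}| \<le>o |A \<times> {xs \<in> lists A. length xs = n}|"
      using card_of_image card_of_mono1 ordLeq_transitive by blast
    moreover have "|A \<times> {xs \<in> lists A. length xs = n}| \<le>o |B|"
      using B(2,3) Suc by (auto intro: card_of_Sigma_ordLeq_infinite)
    ultimately show ?case
      using ordLeq_transitive by blast
  qed
  have "|\<Union>n. {xs \<in> lists A. length xs = n}| \<le>o |B|"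
    using B(2,4) lists by (intro card_of_UNION_ordLeq_infinite) auto
  moreover have "Fpow A \<subseteq> set ` (\<Union>n. {xs \<in> lists A. length xs = n})"
  proof
    fix F assume "F \<in> Fpow A"
    then obtain xs where "set xs = F" "F \<subseteq> A"
      unfolding Fpow_def using finite_list by blast
    then show "F \<in> set ` (\<Union>n. {xs \<in> lists A. length xs = n})"
      by (intro image_eqI[of _ _ xs] UN_I[of "length xs"]) auto
  qed
  ultimately have "|Fpow A| \<le>o |B|"
    by (meson card_of_image card_of_mono1 ordLeq_transitive)
  then show ?thesis
    using B(1) ordLeq_ordLess_trans unfolding small_def by blast
qed

section \<open>Everywhere dominating families and their well-ordering in type \<dd>\<close>

lemma le_sum_atMost: "f n \<le> (\<Sum>i\<le>n. f i)" for f :: "nat \<Rightarrow> nat"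
  by (rule member_le_sum) auto

lemma mono_sum_atMost: "mono (\<lambda>n. \<Sum>i\<le>n. f i)" for f :: "nat \<Rightarrow> nat"
  by (auto intro!: monoI sum_mono2)

lemma everywhere_dominating_family_exists:
  obtains D :: "(nat \<Rightarrow> nat) set" where "|D| =o dominating_number"
    "\<And>h. h \<in> D \<Longrightarrow> mono h" "\<And>h n. h \<in> D \<Longrightarrow> n \<le> h n" "\<And>g. \<exists>h\<in>D. \<forall>n. g n \<le> h n"
proof -
  obtain D where D: "dominating_number = |D|" "\<forall>g. \<exists>f\<in>D. g \<le>\<^sup>* f"
    by (rule dominating_family_exists)
  \<comment> \<open>The constant \<open>c\<close> absorbs the finitely many arguments at which
    \<open>f\<close> fails to dominate, the summand \<open>n\<close> gives
    \<open>n \<le> h n\<close>, and the partial sums give monotonicity.\<close>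
  define \<phi> where "\<phi> = (\<lambda>(f, c) n. c + n + (\<Sum>i\<le>n. f i) :: nat)"
  let ?D = "\<phi> ` (D \<times> (UNIV :: nat set))"
  have dom: "\<exists>h\<in>?D. \<forall>n. g n \<le> h n" for g
  proof -
    obtain f where "f \<in> D" "g \<le>\<^sup>* f" using D(2) by blast
    then obtain N where N: "\<And>n. n \<ge> N \<Longrightarrow> g n \<le> f n"
      unfolding le_star_def eventually_sequentially by blast
    have "g n \<le> \<phi> (f, \<Sum>i\<le>N. g i) n" for n
    proof (cases "n \<ge> N")
      case True
      then show ?thesis
        using N[of n] le_sum_atMost[of f n] by (simp add: \<phi>_def)
    next
      case False
      then have "g n \<le> (\<Sum>i\<le>N. g i)"
        by (intro member_le_sum) auto
      then show ?thesis by (simp add: \<phi>_def)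
    qed
    then show ?thesis using \<open>f \<in> D\<close> by blast
  qed
  have "infinite D"
    using Cinfinite_dominating_number unfolding D(1) cinfinite_def Field_card_of by blast
  then have "|UNIV :: nat set| \<le>o |D|"
    by (simp add: infinite_iff_card_of_nat)
  then have "|D \<times> (UNIV :: nat set)| \<le>o |D|"
    using \<open>infinite D\<close> card_of_mono1[of D D] by (intro card_of_Sigma_ordLeq_infinite) auto
  then have "|?D| \<le>o dominating_number"
    unfolding D(1) by (meson card_of_image ordLeq_transitive)
  moreover have "dominating_number \<le>o |?D|"
  proof (rule dominating_number_le)
    show "\<exists>f\<in>?D. g \<le>\<^sup>* f" for g
      using dom[of g] unfolding le_star_def by (metis (no_types, lifting) always_eventually)
  qed
  ultimately have "|?D| =o dominating_number"
    by (simp add: ordIso_iff_ordLeq)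
  moreover have "mono h" if "h \<in> ?D" for h
    using that by (auto simp: \<phi>_def intro!: monoI add_mono sum_mono2)
  moreover have "n \<le> h n" if "h \<in> ?D" for h n
    using that by (auto simp: \<phi>_def)
  ultimately show ?thesis
    using that[of ?D] dom by blast
qed

text \<open>\<open>card_of D\<close> is a well-order of \<open>D\<close> of least order type, so its
  proper initial segments have smaller cardinality than \<open>D\<close>.\<close>

lemma small_initial_segment:
  assumes "card_of D =o dominating_number" "h \<in> D"
  shows "small (underS (card_of D) h)" "small (insert h (underS (card_of D) h))"
proof -
  have "card_of (underS (card_of D) h) <o card_of D"
    using card_of_underS[OF card_of_Card_order] assms(2) by (simp add: Field_card_of)
  then show "small (underS (card_of D) h)"
    unfolding small_def using assms(1) ordLess_ordIso_trans by blast
  then show "small (insert h (underS (card_of D) h))"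
    using small_Un[of "{h}"] countable_imp_small[of "{h}"] by simp
qed

section \<open>Ultrafilters with ultrapower of large cofinality\<close>

text \<open>Zorn's lemma for the proper filters below \<open>F\<close>, with finer filters counted
  as larger.\<close>

lemma ultrafilter_le_exists:
  fixes F :: "'a filter"
  assumes "F \<noteq> bot"
  obtains U where "ultrafilter U" "U \<le> F"
proof -
  define r where "r = {(G, H :: 'a filter). H \<le> G \<and> G \<le> F \<and> H \<noteq> bot}"
  have field: "G \<in> Field r \<longleftrightarrow> G \<le> F \<and> G \<noteq> bot" for G
  proof
    assume "G \<in> Field r"
    then obtain H where "(G, H) \<in> r \<or> (H, G) \<in> r" unfolding Field_def by blast
    then show "G \<le> F \<and> G \<noteq> bot"
      unfolding r_def using order_trans[of G H F] bot_unique[of H] by blast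
  next
    assume "G \<le> F \<and> G \<noteq> bot"
    then have "(G, G) \<in> r" unfolding r_def by simp
    then show "G \<in> Field r" by (rule FieldI1)
  qed
  have "refl_on (Field r) r"
    by (rule refl_onI) (simp add: field, simp add: r_def)
  moreover have "trans r"
    by (rule transI) (auto simp: r_def)
  moreover have "antisym r"
    by (rule antisymI) (auto simp: r_def)
  ultimately have "Partial_order r"
    unfolding partial_order_on_def preorder_on_def by (auto intro: FieldI1 FieldI2)
  moreover have "\<exists>u\<in>Field r. \<forall>a\<in>C. (a, u) \<in> r" if "C \<in> Chains r" for C
  proof (cases "C = {}")
    case True
    then show ?thesis using assms field by auto
  next
    case False
    have C: "G \<le> F" "G \<noteq> bot" if "G \<in> C" for G
      using that \<open>C \<in> Chains r\<close> field by (auto simp: Chains_def r_def)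
    \<comment> \<open>Along a nonempty chain the infimum acquires no property beyond those of its
      members, which keeps it proper.\<close>
    have "eventually P (Inf C) \<longleftrightarrow> (\<exists>G\<in>C. eventually P G)" for P
      using False \<open>C \<in> Chains r\<close>
      by (intro eventually_Inf_base) (auto simp: Chains_def r_def le_inf_iff)
    then have "Inf C \<noteq> bot"
      using C unfolding trivial_limit_def by simp
    moreover have "Inf C \<le> F"
      using False C(1) Inf_lower2 by blast
    ultimately show ?thesis
      using C(1) field by (auto intro!: bexI[of _ "Inf C"] simp: r_def Inf_lower)
  qed
  ultimately obtain U where U: "U \<in> Field r" "\<forall>a\<in>Field r. (U, a) \<in> r \<longrightarrow> a = U"
    using Zorns_po_lemma[of r] by blast
  \<comment> \<open>If the complement of \<open>P\<close> is not in \<open>U\<close>, restricting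
    \<open>U\<close> to \<open>P\<close> leaves a proper filter, which maximality identifies with
    \<open>U\<close>.\<close>
  have "eventually P U \<or> eventually (\<lambda>x. \<not> P x) U" for P
  proof (rule disjCI)
    assume "\<not> eventually (\<lambda>x. \<not> P x) U"
    then have "inf U (principal {x. P x}) \<noteq> bot"
      unfolding trivial_limit_def eventually_inf_principal by simp
    then have "inf U (principal {x. P x}) = U"
      using U field unfolding r_def by (auto simp: le_infI1)
    then have "U \<le> principal {x. P x}"
      by (metis inf.cobounded2)
    then show "eventually P U"
      by (simp add: le_principal)
  qed
  then show ?thesis
    using that[of U] U(1) field unfolding ultrafilter_def by blast
qed

lemma nonprincipal_if_le_sequentially:
  assumes "U \<noteq> bot" "U \<le> sequentially"
  shows "nonprincipal U"
  unfolding nonprincipal_def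
proof
  assume "\<exists>A. U = principal A"
  then obtain A where A: "U = principal A" by blast
  with assms(1) obtain a where "a \<in> A" by fastforce
  moreover have "eventually (\<lambda>n. n > a) U"
    using assms(2) eventually_gt_at_top filter_leD by blast
  ultimately show False
    unfolding A eventually_principal by blast
qed

lemma ultrafilter_eventually_not:
  assumes "ultrafilter U"
  shows "eventually (\<lambda>x. \<not> P x) U \<longleftrightarrow> \<not> eventually P U"
  using assms eventually_conj[of "\<lambda>x. \<not> P x" U P] unfolding ultrafilter_def
  by (auto simp: trivial_limit_def)

text \<open>The last clause says that the ultrapower of \<open>\<nat>\<close> by \<open>U\<close> has cofinality at least \<open>\<dd>\<close>.\<close>

definition cofinal_ultrafilter :: "nat filter \<Rightarrow> bool" where
  "cofinal_ultrafilter U \<longleftrightarrow> ultrafilter U \<and> U \<le> sequentially \<and>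
     (\<forall>C :: (nat \<Rightarrow> nat) set. small C \<longrightarrow> (\<exists>g. \<forall>c\<in>C. eventually (\<lambda>n. c n \<le> g n) U))"

lemma free_ultrafilter_exists:
  obtains U :: "nat filter" where "ultrafilter U" "U \<le> sequentially"
  using ultrafilter_le_exists[of "sequentially"] by (metis sequentially_bot)

text \<open>Any free ultrafilter will do: fewer than \<bb> functions have a common bound at almost
  all arguments, and \<open>U\<close> contains the cofinite sets.\<close>

lemma cofinal_ultrafilter_if_bounding_eq_dominating:
  assumes "bounding_number =o dominating_number"
  shows "\<exists>U. cofinal_ultrafilter U"
proof -
  obtain U :: "nat filter" where U: "ultrafilter U" "U \<le> sequentially"
    by (rule free_ultrafilter_exists)
  have "\<exists>g. \<forall>c\<in>C. eventually (\<lambda>n. c n \<le> g n) U" if "small C" for C :: "(nat \<Rightarrow> nat) set"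
  proof -
    have "|C| <o bounding_number"
      using \<open>small C\<close> assms ordIso_symmetric ordLess_ordIso_trans unfolding small_def by blast
    then have "\<exists>g. \<forall>f\<in>C. f \<le>\<^sup>* g"
      using min_card_works[of "{B. \<nexists>g. \<forall>f\<in>B. f \<le>\<^sup>* g}"] not_ordLess_ordLeq
      unfolding bounding_number_def by blast
    then show ?thesis
      using U(2) filter_leD unfolding le_star_def by blast
  qed
  then show ?thesis
    using U unfolding cofinal_ultrafilter_def by blast
qed

text \<open>Finitely many functions that each lie below \<open>c\<close> at \<open>U\<close>-many
  arguments do so simultaneously at \<open>U\<close>-many, so their maximum cannot eventually
  dominate the successor of \<open>c\<close>.\<close>

lemma ultrafilter_bounded_in_D_fin:
  assumes "ultrafilter U" "U \<le> sequentially"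
  shows "{f. strict_mono f \<and> eventually (\<lambda>n. f n \<le> c n) U} \<in> D_fin" (is "?E \<in> _")
proof -
  have "\<not> (\<lambda>n. Suc (c n)) \<le>\<^sup>* (\<lambda>n. Max {f n |f. f \<in> G})"
    if "G \<subseteq> ?E" "finite G" "G \<noteq> {}" for G
  proof
    assume "(\<lambda>n. Suc (c n)) \<le>\<^sup>* (\<lambda>n. Max {f n |f. f \<in> G})"
    then have "eventually (\<lambda>n. Suc (c n) \<le> Max {f n |f. f \<in> G}) U"
      using assms(2) filter_leD unfolding le_star_def by blast
    moreover have "eventually (\<lambda>n. \<forall>f\<in>G. f n \<le> c n) U"
      using that by (auto simp: eventually_ball_finite_distrib)
    ultimately have "eventually (\<lambda>n. False) U"
    proof eventually_elim
      case (elim n)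
      have "{f n |f. f \<in> G} = (\<lambda>f. f n) ` G" by blast
      then have "Max {f n |f. f \<in> G} \<le> c n"
        using elim(2) that by simp
      with elim(1) show False by simp
    qed
    then show False
      using assms(1) unfolding ultrafilter_def by (simp add: trivial_limit_def)
  qed
  then have "\<not> finitely_dominating ?E"
    unfolding finitely_dominating_def by blast
  then show ?thesis
    unfolding D_fin_def by blast
qed

lemma strict_mono_majorant:
  fixes g :: "nat \<Rightarrow> nat"
  obtains f where "strict_mono f" "\<And>n. g n \<le> f n"
proof
  show "strict_mono (\<lambda>n. n + (\<Sum>i\<le>n. g i))"
    by (auto simp: strict_mono_Suc_iff)
  show "g n \<le> n + (\<Sum>i\<le>n. g i)" for n
    using le_sum_atMost[of g n] by simp
qed

lemma finitely_dominating_strict_mono: "finitely_dominating {f. strict_mono f}"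
  unfolding finitely_dominating_def
proof
  fix g :: "nat \<Rightarrow> nat"
  obtain f where "strict_mono f" "\<And>n. g n \<le> f n"
    using strict_mono_majorant[of g] by blast
  then show "\<exists>G\<subseteq>{f. strict_mono f}. finite G \<and> G \<noteq> {} \<and> g \<le>\<^sup>* (\<lambda>n. Max {f n |f. f \<in> G})"
    by (intro exI[of _ "{f}"]) (auto simp: le_star_def)
qed

text \<open>If \<open>C\<close> is unbounded modulo \<open>U\<close>, then every \<open>f\<close>
  lies below some \<open>c \<in> C\<close> modulo \<open>U\<close>, as \<open>U\<close> decides
  every set. The increasing functions below a single \<open>c\<close> form a member of
  \<open>D_fin\<close>, so fewer than \<open>additivity D_fin\<close> members would have all
  increasing functions as their union.\<close>

lemma cofinal_ultrafilter_if_additivity_eq_dominating: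
  assumes "additivity D_fin =o dominating_number"
  shows "\<exists>U. cofinal_ultrafilter U"
proof -
  obtain U :: "nat filter" where U: "ultrafilter U" "U \<le> sequentially"
    by (rule free_ultrafilter_exists)
  have "\<exists>g. \<forall>c\<in>C. eventually (\<lambda>n. c n \<le> g n) U" if "small C" for C :: "(nat \<Rightarrow> nat) set"
  proof (rule ccontr)
    assume unbounded: "\<not> ?thesis"
    let ?E = "\<lambda>c. {f. strict_mono f \<and> eventually (\<lambda>n. f n \<le> c n) U}"
    have "|?E ` C| <o additivity D_fin"
      using small_image[OF \<open>small C\<close>, of ?E] assms ordIso_symmetric ordLess_ordIso_trans
      unfolding small_def by blast
    then have "?E ` C \<notin> {\<F>. \<F> \<subseteq> D_fin \<and> \<Union>\<F> \<notin> D_fin}"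
      using min_card_works[of "{\<F>. \<F> \<subseteq> D_fin \<and> \<Union>\<F> \<notin> D_fin}"] not_ordLess_ordLeq
      unfolding additivity_def by blast
    then have "\<Union>(?E ` C) \<in> D_fin"
      using ultrafilter_bounded_in_D_fin[OF U] by blast
    moreover have "\<Union>(?E ` C) = {f. strict_mono f}"
    proof -
      have "\<exists>c\<in>C. eventually (\<lambda>n. f n \<le> c n) U" for f
      proof -
        obtain c where "c \<in> C" "\<not> eventually (\<lambda>n. c n \<le> f n) U"
          using unbounded by blast
        then have "eventually (\<lambda>n. \<not> c n \<le> f n) U"
          using ultrafilter_eventually_not[OF U(1)] by blast
        then have "eventually (\<lambda>n. f n \<le> c n) U"
          by (rule eventually_mono) simp
        then show ?thesis using \<open>c \<in> C\<close> by blast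
      qed
      then show ?thesis by blast
    qed
    ultimately show False
      using finitely_dominating_strict_mono unfolding D_fin_def by simp
  qed
  then show ?thesis
    using U unfolding cofinal_ultrafilter_def by blast
qed

section \<open>Near coherence of filters\<close>

text \<open>Two numbers are close when the larger is at most \<open>h\<close> of the smaller. If
  \<open>h\<close> bounds the fibres of a finite-to-one map, every fibre that meets \<open>A\<close>
  lies inside \<open>near h A\<close>.\<close>

definition near :: "(nat \<Rightarrow> nat) \<Rightarrow> nat set \<Rightarrow> nat set" where
  "near h A = {n. \<exists>m\<in>A. n \<le> m \<and> m \<le> h n \<or> m \<le> n \<and> n \<le> h m}"

text \<open>Otherwise, for every \<open>A\<close> in \<open>U\<close>, the set
  \<open>near h A\<close> contains almost all of some member of \<open>\<B>\<close>. Together with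
  the unbounded family \<open>C\<close> this would yield a small dominating family, indexed by
  \<open>C \<times> \<B>\<close>.\<close>

lemma small_base_avoids_near:
  fixes C :: "(nat \<Rightarrow> nat) set"
  assumes U: "ultrafilter U"
    and "small C" and unbounded: "\<And>g. \<exists>c\<in>C. \<not> eventually (\<lambda>n. c n \<le> g n) U"
    and "small \<B>" and inf: "\<And>B. B \<in> \<B> \<Longrightarrow> infinite B"
    and h: "mono h" "\<And>n. n \<le> h n"
  shows "\<exists>A. eventually (\<lambda>n. n \<in> A) U \<and> (\<forall>B\<in>\<B>. infinite (B - near h A))"
proof (rule ccontr)
  assume "\<not> ?thesis"
  then have trapped: "\<exists>B\<in>\<B>. finite (B - near h A)" if "eventually (\<lambda>n. n \<in> A) U" for A
    using that by blast
  define nxt where "nxt B n = (LEAST b. b \<in> B \<and> n < b)" for B and n :: nat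
  have nxt: "nxt B n \<in> B" "n < nxt B n" if "B \<in> \<B>" for B n
  proof -
    have "\<exists>b. b \<in> B \<and> n < b"
      using inf[OF that] infinite_nat_iff_unbounded by blast
    then have "nxt B n \<in> B \<and> n < nxt B n"
      unfolding nxt_def by (rule LeastI_ex)
    then show "nxt B n \<in> B" "n < nxt B n" by auto
  qed
  \<comment> \<open>The first element of \<open>B\<close> after \<open>h n\<close> will be near some
    \<open>m\<close> in a set of \<open>U\<close>, with \<open>n \<le> m\<close> and
    \<open>m \<le> h (nxt B (h n))\<close>. The sum of \<open>c\<close> up to this last bound
    majorises \<open>c m\<close>.\<close>
  have "small ((\<lambda>(c, B) n. \<Sum>i\<le>h (nxt B (h n)). c i) ` (C \<times> \<B>))"
    by (intro small_image small_Times assms)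
  then obtain g where g: "\<And>f. f \<in> (\<lambda>(c, B) n. \<Sum>i\<le>h (nxt B (h n)). c i) ` (C \<times> \<B>) \<Longrightarrow> \<not> g \<le>\<^sup>* f"
    by (rule small_not_dominating) blast
  obtain c where c: "c \<in> C" "\<not> eventually (\<lambda>n. c n \<le> (\<Sum>i\<le>n. g i)) U"
    using unbounded[of "\<lambda>n. \<Sum>i\<le>n. g i"] by blast
  then have "eventually (\<lambda>n. \<not> c n \<le> (\<Sum>i\<le>n. g i)) U"
    using ultrafilter_eventually_not[OF U] by blast
  then have "eventually (\<lambda>n. n \<in> {n. (\<Sum>i\<le>n. g i) < c n}) U"
    by (simp add: not_le)
  from trapped[OF this] obtain B where B: "B \<in> \<B>" "finite (B - near h {n. (\<Sum>i\<le>n. g i) < c n})" ..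
  then obtain N where N: "\<forall>b\<in>B - near h {n. (\<Sum>i\<le>n. g i) < c n}. b < N"
    by (auto simp: finite_nat_set_iff_bounded)
  have "\<not> g \<le>\<^sup>* (\<lambda>n. \<Sum>i\<le>h (nxt B (h n)). c i)"
    using c(1) B(1) by (intro g image_eqI[of _ _ "(c, B)"]) auto
  then obtain n where n: "n \<ge> N" "g n > (\<Sum>i\<le>h (nxt B (h n)). c i)"
    unfolding le_star_def eventually_sequentially by (meson not_le)
  let ?b = "nxt B (h n)"
  have b: "?b \<in> B" "h n < ?b"
    using nxt B(1) by auto
  then have "?b \<in> near h {n. (\<Sum>i\<le>n. g i) < c n}"
    using bspec[OF N, of ?b] n(1) h(2)[of n] by (meson DiffI le_trans less_le_not_le less_trans)
  then obtain m where m: "(\<Sum>i\<le>m. g i) < c m" "?b \<le> m \<and> m \<le> h ?b \<or> m \<le> ?b \<and> ?b \<le> h m"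
    unfolding near_def by blast
  have "m \<le> h ?b"
    using m(2) h(2)[of ?b] by linarith
  \<comment> \<open>For a smaller \<open>m\<close>, both \<open>m\<close> and \<open>h m\<close>
    would be at most \<open>h n\<close>, hence below \<open>?b\<close>, so \<open>?b\<close> could
    not be close to \<open>m\<close>.\<close>
  have "n \<le> m"
  proof (rule ccontr)
    assume "\<not> n \<le> m"
    then have "h m \<le> h n" "m \<le> h n"
      using h(1) h(2)[of n] by (auto simp: mono_def)
    then show False using m(2) b(2) by linarith
  qed
  have "c m \<le> (\<Sum>i\<le>h ?b. c i)"
    using \<open>m \<le> h ?b\<close> by (intro member_le_sum) auto
  also have "\<dots> < g n" by (rule n(2))
  also have "g n \<le> (\<Sum>i\<le>m. g i)"
    using \<open>n \<le> m\<close> by (intro member_le_sum) auto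
  finally show False using m(1) by simp
qed

text \<open>If \<open>U\<close> were not cofinal, then transfinite recursion along an everywhere dominating family \<open>D\<close>
  of length \<open>\<dd>\<close> would build a second ultrafilter which, for every \<open>h \<in> D\<close>, contains a set that is
  \<open>h\<close>-far from a member of \<open>U\<close>; hence no finite-to-one map could identify the two.\<close>

lemma cofinal_ultrafilter_if_NCF:
  assumes NCF
  shows "\<exists>U. cofinal_ultrafilter U"
proof -
  obtain U :: "nat filter" where U: "ultrafilter U" "U \<le> sequentially"
    by (rule free_ultrafilter_exists)
  have "\<exists>g. \<forall>c\<in>C. eventually (\<lambda>n. c n \<le> g n) U" if "small C" for C :: "(nat \<Rightarrow> nat) set"
  proof (rule ccontr)
    assume "\<not> ?thesis"
    then have unbounded: "\<And>g. \<exists>c\<in>C. \<not> eventually (\<lambda>n. c n \<le> g n) U"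
      by blast
    obtain D :: "(nat \<Rightarrow> nat) set" where D: "|D| =o dominating_number" "\<And>h. h \<in> D \<Longrightarrow> mono h"
      "\<And>h n. h \<in> D \<Longrightarrow> n \<le> h n" "\<And>g. \<exists>h\<in>D. \<forall>n. g n \<le> h n"
      using everywhere_dominating_family_exists by metis
    define r where "r = card_of D - Id"
    have wo: "well_order_on D (card_of D)" and fld: "Field (card_of D) = D"
      by (rule card_of_well_order_on, rule Field_card_of)
    have "wf r"
      using wo unfolding r_def well_order_on_def by blast
    have "trans (card_of D)" "antisym (card_of D)" "total_on D (card_of D)"
      using wo fld unfolding well_order_on_def linear_order_on_def partial_order_on_def preorder_on_def
      by auto
    have r_D: "(y, x) \<in> r \<Longrightarrow> x \<in> D \<and> y \<in> D" for x y
      using fld unfolding r_def by (metis Diff_iff FieldI1 FieldI2)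
    have r_trans: "(x, y) \<in> r \<Longrightarrow> (y, z) \<in> r \<Longrightarrow> (x, z) \<in> r" for x y z
      using \<open>trans _\<close> \<open>antisym _\<close> unfolding r_def trans_def antisym_def by blast
    have r_total: "x \<in> D \<Longrightarrow> y \<in> D \<Longrightarrow> x \<noteq> y \<Longrightarrow> (x, y) \<in> r \<or> (y, x) \<in> r" for x y
      using \<open>total_on D _\<close> unfolding r_def total_on_def by blast
    have max: "\<exists>y\<in>F. \<forall>z\<in>F - {y}. (z, y) \<in> r" if "finite F" "F \<noteq> {}" "F \<subseteq> D" for F
      using that
    proof (induction F rule: finite_ne_induct)
      case (insert x F)
      then obtain y where y: "y \<in> F" "\<And>z. z \<in> F \<Longrightarrow> z \<noteq> y \<Longrightarrow> (z, y) \<in> r" by auto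
      have "(x, y) \<in> r \<or> (y, x) \<in> r"
        using r_total[of x y] insert.hyps insert.prems y(1) by blast
      then show ?case
      proof
        assume "(x, y) \<in> r"
        then show ?thesis using y by (intro bexI[of _ y]) auto
      next
        assume "(y, x) \<in> r"
        then have "(z, x) \<in> r" if "z \<in> F" for z
          using that y(2)[of z] r_trans[of z y x] by blast
        then show ?thesis by (intro bexI[of _ x]) auto
      qed
    qed auto
    \<comment> \<open>The requirement on the set \<open>x\<close> chosen at stage \<open>h\<close>:
      it is far from some set of \<open>U\<close> and meets every finite intersection of earlier
      choices in an infinite set. Nothing is asked outside \<open>D\<close>.\<close>
    define P where "P X h x \<longleftrightarrow> (h \<in> D \<longrightarrow> (\<exists>A. eventually (\<lambda>n. n \<in> A) U \<and> x = - near h A) \<and>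
      (\<forall>F. finite F \<and> (\<forall>z\<in>F. (z, h) \<in> r) \<longrightarrow> infinite (x \<inter> (\<Inter>z\<in>F. X z))))" for X h x
    \<comment> \<open>The requirement at the \<open>r\<close>-last index of \<open>F\<close> already
      covers the whole intersection, the other indices being earlier.\<close>
    have fip: "infinite (\<Inter>z\<in>F. X z)" if F: "finite F" "F \<subseteq> D" "\<And>y. y \<in> F \<Longrightarrow> P X y (X y)" for X F
    proof (cases "F = {}")
      case False
      then obtain y where y: "y \<in> F" "\<forall>z\<in>F - {y}. (z, y) \<in> r"
        using max[OF F(1) False F(2)] by blast
      then have "infinite (X y \<inter> (\<Inter>z\<in>F - {y}. X z))"
        using F(1,2) F(3)[OF y(1)] y unfolding P_def by (metis finite_Diff subsetD)
      moreover have "X y \<inter> (\<Inter>z\<in>F - {y}. X z) = (\<Inter>z\<in>F. X z)"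
        using y(1) by blast
      ultimately show ?thesis by simp
    qed simp
    have "\<exists>X. \<forall>h. P X h (X h)"
    proof (rule dependent_wf_choice[OF \<open>wf r\<close>])
      fix X Y :: "(nat \<Rightarrow> nat) \<Rightarrow> nat set" and h x assume eq: "\<And>z. (z, h) \<in> r \<Longrightarrow> X z = Y z"
      have "(\<Inter>z\<in>F. X z) = (\<Inter>z\<in>F. Y z)" if "\<forall>z\<in>F. (z, h) \<in> r" for F
        using that eq by auto
      then show "P X h x = P Y h x"
        unfolding P_def by (metis (no_types, lifting))
    next
      fix h and X :: "(nat \<Rightarrow> nat) \<Rightarrow> nat set" assume IH: "\<And>y. (y, h) \<in> r \<Longrightarrow> P X y (X y)"
      show "\<exists>x. P X h x"
      proof (cases "h \<in> D")
        case True
        let ?S = "underS (card_of D) h"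
        have S: "z \<in> ?S \<longleftrightarrow> (z, h) \<in> r" for z
          unfolding underS_def r_def by auto
        \<comment> \<open>Fewer than \<dd> indices precede \<open>h\<close>, so the finite
          intersections of earlier choices form a small family.\<close>
        let ?B = "(\<lambda>F. \<Inter>z\<in>F. X z) ` Fpow ?S"
        have "small ?B"
          using small_initial_segment(1)[OF D(1) True] by (intro small_image small_Fpow)
        moreover have "infinite B" if B: "B \<in> ?B" for B
        proof -
          obtain F where F: "B = (\<Inter>z\<in>F. X z)" "finite F" "F \<subseteq> ?S"
            using B unfolding Fpow_def by blast
          then have "(z, h) \<in> r" if "z \<in> F" for z
            using that S by blast
          then have "F \<subseteq> D" "\<And>z. z \<in> F \<Longrightarrow> P X z (X z)"
            using IH r_D by blast+
          then show ?thesis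
            unfolding F(1) by (rule fip[OF F(2)])
        qed
        ultimately have "\<exists>A. eventually (\<lambda>n. n \<in> A) U \<and> (\<forall>B\<in>?B. infinite (B - near h A))"
          by (rule small_base_avoids_near[OF U(1) \<open>small C\<close> unbounded _ _ D(2)[OF True] D(3)[OF True]])
        then obtain A where A: "eventually (\<lambda>n. n \<in> A) U" "\<forall>B\<in>?B. infinite (B - near h A)"
          by blast
        have "infinite (- near h A \<inter> (\<Inter>z\<in>F. X z))" if "finite F" "\<forall>z\<in>F. (z, h) \<in> r" for F
        proof -
          have "F \<in> Fpow ?S" using that S by (auto simp: Fpow_def)
          then have "infinite ((\<Inter>z\<in>F. X z) - near h A)" using A(2) by blast
          then show ?thesis by (simp add: Diff_eq Int_commute)
        qed
        then show ?thesis
          using A(1) unfolding P_def by blast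
      qed (simp add: P_def)
    qed
    then obtain X where X: "\<And>h. P X h (X h)" by blast
    \<comment> \<open>The factor \<open>sequentially\<close> makes every ultrafilter below
      \<open>F\<close> nonprincipal; \<open>F\<close> stays proper because the finite intersections
      are infinite, not merely nonempty.\<close>
    define F where "F = inf sequentially (INF h\<in>D. principal (X h))"
    have "F \<noteq> bot"
    proof
      assume "F = bot"
      then have "eventually (\<lambda>n. False) F" by simp
      then obtain P1 P2 where P12: "eventually P1 sequentially" "eventually P2 (INF h\<in>D. principal (X h))"
        "\<And>n. \<not> (P1 n \<and> P2 n)"
        unfolding F_def eventually_inf by blast
      then obtain G where G: "G \<subseteq> D" "finite G" "eventually P2 (INF h\<in>G. principal (X h))"
        using eventually_INF by metis
      then have "\<forall>n\<in>(\<Inter>z\<in>G. X z). P2 n"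
        by (simp add: INF_principal_finite eventually_principal)
      moreover obtain N where "\<And>n. n \<ge> N \<Longrightarrow> P1 n"
        using P12(1) unfolding eventually_sequentially by blast
      ultimately have "(\<Inter>z\<in>G. X z) \<subseteq> {..<N}"
        using P12(3) by (meson lessThan_iff not_le subsetI)
      then show False
        using fip[of G X] G X finite_subset by blast
    qed
    then obtain V where V: "ultrafilter V" "V \<le> F"
      by (rule ultrafilter_le_exists)
    have V_X: "eventually (\<lambda>n. n \<in> X h) V" if "h \<in> D" for h
    proof -
      have "F \<le> principal (X h)"
        unfolding F_def using that by (auto intro: le_infI2 INF_lower)
      then show ?thesis
        using V(2) le_principal order_trans by blast
    qed
    have "U \<noteq> bot" "V \<noteq> bot" "V \<le> sequentially"
      using U V unfolding ultrafilter_def F_def by auto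
    then have "nonprincipal U" "nonprincipal V"
      using U(2) nonprincipal_if_le_sequentially by simp_all
    then obtain f :: "nat \<Rightarrow> nat" where f: "\<And>n. finite (f -` {n})" "filtermap f U = filtermap f V"
      using assms U(1) V(1) unfolding NCF_def by meson
    \<comment> \<open>\<open>h n\<close> bounds the fibre of \<open>f\<close> through
      \<open>n\<close>, so that points with equal image are close in the sense of
      \<open>near\<close>.\<close>
    obtain h where h: "h \<in> D" "\<And>n. Max (f -` {f n}) \<le> h n"
      using D(4)[of "\<lambda>n. Max (f -` {f n})"] by blast
    have fh: "m \<le> h n" if "f m = f n" for m n
      using that Max_ge[OF f(1)[of "f n"], of m] h(2)[of n] by simp
    obtain A where A: "eventually (\<lambda>n. n \<in> A) U" "X h = - near h A"
      using X[of h] h(1) unfolding P_def by blast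
    \<comment> \<open>Equality of the image filters puts the preimage of the image of
      \<open>A\<close> into \<open>V\<close>. It then meets \<open>X h\<close>, which contains
      nothing near \<open>A\<close>.\<close>
    have "eventually (\<lambda>y. y \<in> f ` A) (filtermap f U)"
      unfolding eventually_filtermap using A(1) by (rule eventually_mono) simp
    then have "eventually (\<lambda>n. f n \<in> f ` A) V"
      unfolding f(2) eventually_filtermap .
    then have "eventually (\<lambda>n. f n \<in> f ` A \<and> n \<in> X h) V"
      using V_X[OF h(1)] by (rule eventually_conj)
    then obtain n where n: "f n \<in> f ` A" "n \<in> X h"
      using \<open>V \<noteq> bot\<close> eventually_happens[of _ V] by (metis (mono_tags, lifting))
    then obtain m where "m \<in> A" "f m = f n" by auto
    then have "n \<in> near h A"
      using fh[of m n] fh[of n m] unfolding near_def by (metis (mono_tags, lifting) mem_Collect_eq nat_le_linear)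
    then show False using n(2) A(2) by blast
  qed
  then show ?thesis
    using U unfolding cofinal_ultrafilter_def by blast
qed

section \<open>Gaps and neighbourhoods of \<open>Q\<close>\<close>

definition emb :: "(nat \<Rightarrow> nat) \<Rightarrow> nat \<Rightarrow> enat" where
  "emb f = (\<lambda>i. enat (f i))"

definition gap :: "(nat \<Rightarrow> nat) \<Rightarrow> (nat \<Rightarrow> nat) \<Rightarrow> nat set" where
  "gap f H = {n. range f \<inter> {n<..H n} = {}}"

lemma gap_antimono:
  assumes "G n \<le> H n" "n \<in> gap f H"
  shows "n \<in> gap f G"
proof -
  have "{n<..G n} \<subseteq> {n<..H n}" using assms(1) by auto
  then show ?thesis using assms(2) unfolding gap_def by blast
qed

lemma inj_emb: "inj emb"
  unfolding emb_def by (rule injI) (metis enat.inject ext)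

lemma emb_not_in_Q: "emb f \<notin> Q"
proof
  assume "emb f \<in> Q"
  then obtain s where "emb f = q_seq s" unfolding Q_def by blast
  then have "emb f (card s) = q_seq s (card s)" by simp
  then show False by (simp add: emb_def q_seq_def)
qed

lemma countable_Q: "countable Q"
  unfolding Q_def by (intro countable_image countable_Collect_finite)

lemma Q_subset_incr_space: "Q \<subseteq> incr_space"
proof
  fix q assume "q \<in> Q"
  then obtain s where s: "finite s" "q = q_seq s" unfolding Q_def by blast
  let ?l = "sorted_list_of_set s"
  have len: "length ?l = card s" by simp
  have less: "?l ! i < ?l ! j" if "i < j" "j < card s" for i j
    using that len sorted_wrt_nth_less[OF strict_sorted_list_of_set[of s]] by simp
  have "q i \<le> q j" if "i \<le> j" for i j
    using less[of i j] that by (cases "i = j") (auto simp: s(2) q_seq_def)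
  moreover have "q n < q (Suc n)" if "q n < \<infinity>" for n
    using less[of n "Suc n"] that by (auto simp: s(2) q_seq_def split: if_splits)
  ultimately show "q \<in> incr_space"
    unfolding incr_space_def by (simp add: mono_def)
qed

lemma emb_in_incr_space: "strict_mono f \<Longrightarrow> emb f \<in> incr_space"
  unfolding incr_space_def emb_def by (auto simp: mono_def strict_mono_less_eq strict_mono_Suc_iff)

lemma q_seq_initial_segment:
  assumes "strict_mono f"
  shows "q_seq (f ` {..<c}) = (\<lambda>i. if i < c then enat (f i) else \<infinity>)" "card (f ` {..<c}) = c"
proof -
  have inj: "inj_on f A" for A
    using assms strict_mono_imp_inj_on inj_on_subset by blast
  show card: "card (f ` {..<c}) = c"
    by (simp add: card_image inj)
  have "sorted (map f [0..<c])"
    using assms by (auto simp: sorted_iff_nth_mono strict_mono_less_eq)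
  moreover have "distinct (map f [0..<c])"
    by (simp add: distinct_map inj)
  moreover have "f ` {..<c} = set (map f [0..<c])"
    by (simp add: atLeast0LessThan)
  ultimately have "sorted_list_of_set (f ` {..<c}) = map f [0..<c]"
    using sorted_list_of_set.idem_if_sorted_distinct by metis
  then show "q_seq (f ` {..<c}) = (\<lambda>i. if i < c then enat (f i) else \<infinity>)"
    unfolding q_seq_def card by auto
qed

text \<open>A basic open box around \<open>q\<close> restricts finitely many coordinates. Those
  below \<open>c\<close> are handled by agreement with \<open>q\<close>; at the others the box
  contains a ray up to \<infinity>, and the sum of the thresholds serves all of them.\<close>

lemma open_contains_tail_neighbourhood:
  fixes q :: "nat \<Rightarrow> enat"
  assumes "open W" "q \<in> W" "\<And>i. i \<ge> c \<Longrightarrow> q i = \<infinity>"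
  shows "\<exists>k. \<forall>x. (\<forall>i<c. x i = q i) \<and> (\<forall>i\<ge>c. enat k < x i) \<longrightarrow> x \<in> W"
proof -
  have "openin (product_topology (\<lambda>i. euclidean) UNIV) W"
    using assms(1) open_fun_def by auto
  then obtain X where X: "q \<in> (\<Pi>\<^sub>E i\<in>UNIV. X i)" "\<And>i. openin euclidean (X i)"
      "finite {i. X i \<noteq> topspace euclidean}" "(\<Pi>\<^sub>E i\<in>UNIV. X i) \<subseteq> W"
    using product_topology_open_contains_basis[OF _ assms(2)] by blast
  have "\<exists>k. {enat k<..} \<subseteq> X i" if "i \<ge> c" for i
  proof -
    have "\<infinity> \<in> X i" "open (X i)"
      using X(1) X(2)[of i] assms(3)[OF that] by (auto simp: PiE_iff) metis
    then show ?thesis by (simp add: open_enat_iff)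
  qed
  then obtain k where k: "\<And>i. i \<ge> c \<Longrightarrow> {enat (k i)<..} \<subseteq> X i"
    by metis
  let ?I = "{i. X i \<noteq> UNIV}"
  have fin: "finite ?I" using X(3) by simp
  have "x \<in> W" if x: "\<forall>i<c. x i = q i" "\<forall>i\<ge>c. enat (\<Sum>i\<in>?I. k i) < x i" for x
  proof -
    have "x i \<in> X i" for i
    proof (cases "i < c \<or> i \<notin> ?I")
      case True
      then show ?thesis using X(1) x(1) by (auto simp: PiE_iff)
    next
      case False
      then have "k i \<le> (\<Sum>i\<in>?I. k i)"
        using fin by (intro member_le_sum) auto
      then have "enat (k i) < x i"
        using False x(2) by (meson enat_ord_simps(1) le_less_trans not_less)
      then show ?thesis using k[of i] False by auto
    qed
    then show ?thesis using X(4) by auto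
  qed
  then show ?thesis by blast
qed

text \<open>A sequence missing \<open>{n<..N}\<close> agrees with \<open>q_seq s\<close>, for
  \<open>s\<close> its set of values up to \<open>n\<close>, and afterwards lies beyond
  \<open>N\<close>. Only finitely many \<open>s\<close> occur, so one \<open>N\<close> can exceed
  all their thresholds.\<close>

lemma gap_neighbourhood:
  assumes "open W" "\<And>s. s \<subseteq> {..n} \<Longrightarrow> q_seq s \<in> W"
  shows "\<exists>N. \<forall>f. strict_mono f \<and> range f \<inter> {n<..N} = {} \<longrightarrow> emb f \<in> W"
proof -
  have "\<forall>s\<in>Pow {..n}. \<exists>k. \<forall>x. (\<forall>i<card s. x i = q_seq s i) \<and> (\<forall>i\<ge>card s. enat k < x i) \<longrightarrow> x \<in> W"
  proof
    fix s assume "s \<in> Pow {..n}"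
    then have "q_seq s \<in> W" using assms(2) by simp
    moreover have "q_seq s i = \<infinity>" if "i \<ge> card s" for i
      using that by (simp add: q_seq_def)
    ultimately show "\<exists>k. \<forall>x. (\<forall>i<card s. x i = q_seq s i) \<and> (\<forall>i\<ge>card s. enat k < x i) \<longrightarrow> x \<in> W"
      by (rule open_contains_tail_neighbourhood[OF assms(1)])
  qed
  then obtain k where k: "\<And>s x. s \<subseteq> {..n} \<Longrightarrow> (\<And>i. i < card s \<Longrightarrow> x i = q_seq s i) \<Longrightarrow>
      (\<And>i. i \<ge> card s \<Longrightarrow> enat (k s) < x i) \<Longrightarrow> x \<in> W"
    by (metis PowI)
  have "emb f \<in> W" if f: "strict_mono f" "range f \<inter> {n<..(\<Sum>s\<in>Pow {..n}. k s)} = {}" for f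
  proof -
    \<comment> \<open>The index of the first value beyond \<open>n\<close> is also the number of
      values up to \<open>n\<close>.\<close>
    define c where "c = (LEAST i. n < f i)"
    have "n < f (Suc n)"
      using strict_mono_imp_increasing[OF f(1), of "Suc n"] by simp
    then have c: "n < f c"
      unfolding c_def by (rule LeastI)
    have below: "f i \<le> n" if "i < c" for i
      using not_less_Least[of i "\<lambda>i. n < f i"] that unfolding c_def by simp
    have above: "n < f i" if "i \<ge> c" for i
      using c strict_mono_less_eq[OF f(1), of c i] that by simp
    show ?thesis
    proof (rule k[of "f ` {..<c}"])
      show sub: "f ` {..<c} \<subseteq> {..n}" using below by auto
      show "emb f i = q_seq (f ` {..<c}) i" if "i < card (f ` {..<c})" for i
        using that q_seq_initial_segment[OF f(1)] by (simp add: emb_def)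
      show "enat (k (f ` {..<c})) < emb f i" if "i \<ge> card (f ` {..<c})" for i
      proof -
        have "n < f i"
          using that above q_seq_initial_segment(2)[OF f(1)] by simp
        then have "(\<Sum>s\<in>Pow {..n}. k s) < f i"
          using f(2) by (metis disjoint_iff greaterThanAtMost_iff not_less rangeI)
        moreover have "k (f ` {..<c}) \<le> (\<Sum>s\<in>Pow {..n}. k s)"
          using sub by (intro member_le_sum) auto
        ultimately show ?thesis by (simp add: emb_def)
      qed
    qed
  qed
  then show ?thesis by blast
qed

section \<open>Diagonal construction of sequences with gaps\<close>

text \<open>The member with index \<open>h\<close> in a dominating \<open>D\<close> of type \<dd> is
  made to satisfy \<open>\<Phi>\<close> for \<open>h\<close> and all its predecessors. Any
  \<open>H\<close> lies below some \<open>c \<in> D\<close>, and only the indices before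
  \<open>c\<close> can be exceptional. The abstract \<open>\<Phi>\<close> stands for one gap or for
  \<open>U\<close>-many gaps.\<close>

lemma diagonal_family:
  fixes \<Phi> :: "(nat \<Rightarrow> nat) \<Rightarrow> (nat \<Rightarrow> nat) \<Rightarrow> bool"
  assumes step: "\<And>h C. small C \<Longrightarrow> (\<And>c. c \<in> C \<Longrightarrow> mono c) \<Longrightarrow> mono h \<Longrightarrow>
      \<exists>f. strict_mono f \<and> (\<forall>n. h n \<le> f n) \<and> (\<forall>c\<in>C. \<Phi> f c)"
    and antimono: "\<And>f G H. (\<And>n. G n \<le> H n) \<Longrightarrow> \<Phi> f H \<Longrightarrow> \<Phi> f G"
  obtains R where "|R| \<le>o dominating_number" "\<forall>f\<in>R. strict_mono f" "\<forall>g. \<exists>f\<in>R. \<forall>n. g n \<le> f n"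
    "\<forall>H. \<exists>E. small E \<and> (\<forall>f\<in>R - E. \<Phi> f H)"
proof -
  obtain D :: "(nat \<Rightarrow> nat) set" where D: "|D| =o dominating_number" "\<And>h. h \<in> D \<Longrightarrow> mono h"
    "\<And>g. \<exists>h\<in>D. \<forall>n. g n \<le> h n"
    using everywhere_dominating_family_exists by metis
  let ?S = "underS (card_of D)"
  have sub: "?S h \<subseteq> D" for h
    unfolding underS_def using FieldI1 Field_card_of by fastforce
  have "\<exists>f. strict_mono f \<and> (\<forall>n. h n \<le> f n) \<and> (\<forall>c\<in>insert h (?S h). \<Phi> f c)" if "h \<in> D" for h
    using step[OF small_initial_segment(2)[OF D(1) that]] D(2) that sub by blast
  then obtain F where F: "\<And>h. h \<in> D \<Longrightarrow> strict_mono (F h)" "\<And>h n. h \<in> D \<Longrightarrow> h n \<le> F h n"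
      "\<And>h c. h \<in> D \<Longrightarrow> c \<in> insert h (?S h) \<Longrightarrow> \<Phi> (F h) c"
    by metis
  have total: "total_on D (card_of D)"
    using card_of_well_order_on[of D] unfolding well_order_on_def linear_order_on_def by blast
  show ?thesis
  proof (rule that[of "F ` D"])
    show "|F ` D| \<le>o dominating_number"
      using card_of_image D(1) ordLeq_ordIso_trans by blast
    show "\<forall>f\<in>F ` D. strict_mono f" using F(1) by blast
    show "\<forall>g. \<exists>f\<in>F ` D. \<forall>n. g n \<le> f n"
      using D(3) F(2) by (metis image_eqI order_trans)
    show "\<forall>H. \<exists>E. small E \<and> (\<forall>f\<in>F ` D - E. \<Phi> f H)"
    proof
      fix H
      obtain c where c: "c \<in> D" "\<And>n. H n \<le> c n" using D(3) by blast
      have "\<Phi> (F h) H" if "h \<in> D" "h \<notin> ?S c" for h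
      proof -
        have "c \<in> insert h (?S h)"
          using total c(1) that unfolding total_on_def underS_def by blast
        then show ?thesis by (rule antimono[OF c(2) F(3)[OF that(1)]])
      qed
      then show "\<exists>E. small E \<and> (\<forall>f\<in>F ` D - E. \<Phi> f H)"
        using small_image[OF small_initial_segment(1)[OF D(1) c(1)], of F] by blast
    qed
  qed
qed

text \<open>If \<open>f\<close> has no gap for a monotone \<open>c\<close>, every number
  \<open>n\<close> is followed by a value of \<open>f\<close> up to \<open>c n\<close>, so iterates
  of \<open>c\<close> at zero bound \<open>f\<close>. A sequence above some \<open>g\<close> that
  none of these iterations dominates therefore has gaps.\<close>

lemma gap_family:
  obtains R where "|R| \<le>o dominating_number" "\<forall>f\<in>R. strict_mono f" "\<forall>g. \<exists>f\<in>R. \<forall>n. g n \<le> f n"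
    "\<forall>H. \<exists>E. small E \<and> (\<forall>f\<in>R - E. gap f H \<noteq> {})"
proof (rule diagonal_family[of "\<lambda>f H. gap f H \<noteq> {}"])
  fix h :: "nat \<Rightarrow> nat" and C :: "(nat \<Rightarrow> nat) set"
  assume C: "small C" "\<And>c. c \<in> C \<Longrightarrow> mono c"
  have "small ((\<lambda>c i. (c ^^ Suc i) 0) ` C)"
    using C(1) by (rule small_image)
  then obtain g where g: "\<And>f. f \<in> (\<lambda>c i. (c ^^ Suc i) 0) ` C \<Longrightarrow> \<not> g \<le>\<^sup>* f"
    by (rule small_not_dominating) blast
  obtain f where f: "strict_mono f" "\<And>n. g n + h n \<le> f n"
    using strict_mono_majorant[of "\<lambda>n. g n + h n"] by blast
  have "gap f c \<noteq> {}" if "c \<in> C" for c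
  proof
    assume no_gap: "gap f c = {}"
    have meets: "\<exists>j. n < f j \<and> f j \<le> c n" for n
    proof -
      have "n \<notin> gap f c" using no_gap by simp
      then show ?thesis unfolding gap_def by auto
    qed
    have "f i \<le> (c ^^ Suc i) 0" for i
    proof (induction i)
      case 0
      obtain j where "f j \<le> c 0" using meets by blast
      moreover have "f 0 \<le> f j" using f(1) by (simp add: strict_mono_less_eq)
      ultimately show ?case by simp
    next
      case (Suc i)
      obtain j where j: "f i < f j" "f j \<le> c (f i)" using meets by blast
      then have "f (Suc i) \<le> f j" using f(1) by (simp add: strict_mono_less_eq strict_mono_less)
      also have "\<dots> \<le> c (f i)" by (rule j(2))
      also have "\<dots> \<le> c ((c ^^ Suc i) 0)"
        using C(2)[OF that] Suc by (simp add: mono_def)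
      finally show ?case by simp
    qed
    then have "g i \<le> (c ^^ Suc i) 0" for i
      using f(2)[of i] by (meson add_leE le_trans)
    then have "g \<le>\<^sup>* (\<lambda>i. (c ^^ Suc i) 0)"
      unfolding le_star_def by simp
    then show False using g that by blast
  qed
  then show "\<exists>f. strict_mono f \<and> (\<forall>n. h n \<le> f n) \<and> (\<forall>c\<in>C. gap f c \<noteq> {})"
    using f by (meson add_leE)
next
  fix f G H :: "nat \<Rightarrow> nat" assume "\<And>n. G n \<le> H n" "gap f H \<noteq> {}"
  then show "gap f G \<noteq> {}" using gap_antimono[of G _ H f] by blast
qed

text \<open>One \<open>g\<close> bounds all functions of \<open>C\<close> modulo \<open>U\<close>.
  The naturals are cut into blocks that grow faster than \<open>g\<close>; \<open>U\<close> contains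
  the union of the even or of the odd blocks, and a sequence of left ends of blocks of that parity
  has a gap for \<open>g\<close> at each point of the union.\<close>

lemma ultrafilter_gap_family:
  assumes "cofinal_ultrafilter U"
  obtains R where "|R| \<le>o dominating_number" "\<forall>f\<in>R. strict_mono f" "\<forall>g. \<exists>f\<in>R. \<forall>n. g n \<le> f n"
    "\<forall>H. \<exists>E. small E \<and> (\<forall>f\<in>R - E. eventually (\<lambda>n. n \<in> gap f H) U)"
proof (rule diagonal_family[of "\<lambda>f H. eventually (\<lambda>n. n \<in> gap f H) U"])
  fix h :: "nat \<Rightarrow> nat" and C :: "(nat \<Rightarrow> nat) set"
  assume C: "small C" and "mono h"
  obtain g0 where g0: "\<And>c. c \<in> C \<Longrightarrow> eventually (\<lambda>n. c n \<le> g0 n) U"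
    using assms C unfolding cofinal_ultrafilter_def by blast
  define g where "g n = (\<Sum>i\<le>n. g0 i + h i)" for n
  have g: "mono g" "g0 n \<le> g n" "h n \<le> g n" for n
    using mono_sum_atMost[of "\<lambda>i. g0 i + h i"] le_sum_atMost[of "\<lambda>i. g0 i + h i" n]
    unfolding g_def by auto
  define a where "a k = ((\<lambda>x. Suc (x + g x)) ^^ k) 0" for k
  have a_Suc: "a (Suc k) = Suc (a k + g (a k))" for k
    unfolding a_def by simp
  then have a_mono: "strict_mono a"
    by (simp add: strict_mono_Suc_iff)
  have blocks: "\<exists>k. a k \<le> n \<and> n < a (Suc k)" for n
  proof (induction n)
    case 0
    show ?case by (rule exI[of _ 0]) (simp add: a_def)
  next
    case (Suc n)
    then obtain k where "a k \<le> n" "n < a (Suc k)" by blast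
    then have "a k \<le> Suc n \<and> Suc n < a (Suc k) \<or> a (Suc k) \<le> Suc n \<and> Suc n < a (Suc (Suc k))"
      using strict_monoD[OF a_mono, of "Suc k" "Suc (Suc k)"] by linarith
    then show ?case by blast
  qed
  define B where "B e = {n. \<exists>k. a (2 * k + e) \<le> n \<and> n < a (Suc (2 * k + e))}" for e
  have cover: "n \<in> B 0 \<or> n \<in> B 1" for n
  proof -
    obtain k where "a k \<le> n" "n < a (Suc k)" using blocks by blast
    then have "n \<in> B (k mod 2)"
      unfolding B_def by (auto intro!: exI[of _ "k div 2"])
    then show ?thesis by (metis mod2_eq_if)
  qed
  have "eventually (\<lambda>n. n \<in> B 1) U" if "eventually (\<lambda>n. n \<notin> B 0) U"
    using that by eventually_elim (use cover in blast)
  moreover have "eventually (\<lambda>n. n \<in> B 0) U \<or> eventually (\<lambda>n. n \<notin> B 0) U"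
    using assms unfolding cofinal_ultrafilter_def ultrafilter_def by blast
  ultimately obtain e where e: "eventually (\<lambda>n. n \<in> B e) U"
    by blast
  \<comment> \<open>Starting at index \<open>2 + e\<close> leaves \<open>a (2 * n + 1 + e)\<close>
    before \<open>f n\<close>; it is at least \<open>n\<close>, and \<open>f n\<close> exceeds the
    value of \<open>g\<close>, hence of \<open>h\<close>, there.\<close>
  define f where "f i = a (2 * i + 2 + e)" for i
  have f: "strict_mono f"
    using a_mono unfolding f_def by (simp add: strict_mono_def)
  have "h n \<le> f n" for n
  proof -
    have "h n \<le> h (a (2 * n + 1 + e))"
      using \<open>mono h\<close> strict_mono_imp_increasing[OF a_mono, of "2 * n + 1 + e"] by (intro monoD[OF \<open>mono h\<close>]) simp
    also have "\<dots> \<le> f n"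
      using g(3)[of "a (2 * n + 1 + e)"] a_Suc[of "2 * n + 1 + e"] by (simp add: f_def)
    finally show ?thesis .
  qed
  moreover have gap_g: "n \<in> gap f g" if n: "n \<in> B e" for n
  proof -
    obtain k where k: "a (2 * k + e) \<le> n" "n < a (Suc (2 * k + e))"
      using n unfolding B_def by blast
    \<comment> \<open>A value beyond \<open>n\<close> is at least the second block boundary after
      \<open>n\<close>, and that boundary exceeds \<open>g\<close> at the first.\<close>
    have "g n < f i" if "n < f i" for i
    proof -
      have "a (2 * k + e) < a (2 * i + 2 + e)" using k(1) that unfolding f_def by simp
      then have "2 * k + e < 2 * i + 2 + e" using a_mono by (simp add: strict_mono_less)
      then have "Suc (Suc (2 * k + e)) \<le> 2 * i + 2 + e" by simp
      then have "a (Suc (Suc (2 * k + e))) \<le> f i"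
        using a_mono unfolding f_def by (simp add: strict_mono_less_eq)
      moreover have "g n \<le> g (a (Suc (2 * k + e)))"
        using k(2) by (intro monoD[OF g(1)]) simp
      ultimately show ?thesis by (simp add: a_Suc)
    qed
    then show ?thesis unfolding gap_def by fastforce
  qed
  moreover have "eventually (\<lambda>n. n \<in> gap f c) U" if "c \<in> C" for c
    using g0[OF that] e
  proof eventually_elim
    case (elim n)
    then have "n \<in> gap f g" "c n \<le> g n"
      using gap_g[of n] g(2)[of n] by simp_all
    then show ?case using gap_antimono[of c n g f] by simp
  qed
  ultimately show "\<exists>f. strict_mono f \<and> (\<forall>n. h n \<le> f n) \<and> (\<forall>c\<in>C. eventually (\<lambda>n. n \<in> gap f c) U)"
    using f by blast
next
  fix f G H :: "nat \<Rightarrow> nat" assume "\<And>n. G n \<le> H n" "eventually (\<lambda>n. n \<in> gap f H) U"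
  then show "eventually (\<lambda>n. n \<in> gap f G) U"
    using gap_antimono[of G _ H f] by (auto elim: eventually_mono)
qed

section \<open>Selection principles\<close>

text \<open>The covers of even index are spent on the points of \<open>Q\<close>; the chosen members
  then contain all but a small set of sequences. For the exceptions, each cover of odd index gives
  thresholds beyond which a point stays covered, and a function not dominated by these thresholds
  selects the members.\<close>

lemma S_1_gamma_open:
  assumes R: "\<forall>f\<in>R. strict_mono f" and conc: "\<forall>H. \<exists>E. small E \<and> (\<forall>f\<in>R - E. gap f H \<noteq> {})"
  shows "S_1 gamma_covers open_covers (top_of_set (Q \<union> emb ` R))"
  unfolding S_1_def
proof (intro allI impI)
  fix \<U> :: "nat \<Rightarrow> (nat \<Rightarrow> enat) set set"
  let ?M = "Q \<union> emb ` R"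
  assume \<U>: "\<forall>n. \<U> n \<in> gamma_covers (top_of_set ?M)"
  have cnt: "countable (\<U> n)" and opn: "U \<in> \<U> n \<Longrightarrow> openin (top_of_set ?M) U"
    and cov: "\<Union>(\<U> n) = ?M" and inf: "infinite (\<U> n)"
    and gam: "x \<in> ?M \<Longrightarrow> finite {U \<in> \<U> n. x \<notin> U}" for n U x
    using \<U>[rule_format, of n] unfolding gamma_covers_def open_covers_def by simp_all
  define q where "q = from_nat_into Q"
  have "Q \<noteq> {}" unfolding Q_def by blast
  then have range_q: "range q = Q"
    unfolding q_def using countable_Q by (rule range_from_nat_into)
  have "\<exists>V. V \<in> \<U> (2 * n) \<and> q n \<in> V" for n
  proof -
    have "q n \<in> \<Union>(\<U> (2 * n))"
      unfolding cov using range_q by blast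
    then show ?thesis by blast
  qed
  then obtain V where V: "\<And>n. V n \<in> \<U> (2 * n)" "\<And>n. q n \<in> V n"
    by metis
  have "\<exists>T. open T \<and> V n = ?M \<inter> T" for n
    using opn[OF V(1)] by (simp add: openin_open)
  then obtain T where T: "\<And>n. open (T n)" "\<And>n. V n = ?M \<inter> T n"
    by metis
  let ?W = "\<Union>n. T n"
  have "open ?W" using T(1) by blast
  have "q_seq s \<in> ?W" if "s \<subseteq> {..n}" for s n
  proof -
    have "q_seq s \<in> Q"
      using that finite_subset unfolding Q_def by blast
    then obtain i where "q i = q_seq s" using range_q by (metis imageE)
    then show ?thesis using V(2)[of i] T(2)[of i] by auto
  qed
  then have "\<exists>N. \<forall>f. strict_mono f \<and> range f \<inter> {n<..N} = {} \<longrightarrow> emb f \<in> ?W" for n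
    by (intro gap_neighbourhood[OF \<open>open ?W\<close>])
  then obtain H where H: "\<And>n f. strict_mono f \<Longrightarrow> range f \<inter> {n<..H n} = {} \<Longrightarrow> emb f \<in> ?W"
    by metis
  obtain E where E: "small E" "\<And>f. f \<in> R - E \<Longrightarrow> gap f H \<noteq> {}"
    using conc by blast
  have in_W: "emb f \<in> ?W" if "f \<in> R - E" for f
  proof -
    have "gap f H \<noteq> {}" "strict_mono f" using E(2) R that by auto
    then show ?thesis using H[of f] unfolding gap_def by blast
  qed
  \<comment> \<open>The members of a countable infinite cover are numbered, so that a point misses
    only finitely many numbers.\<close>
  define e where "e n = from_nat_into (\<U> (Suc (2 * n)))" for n
  have e: "bij_betw (e n) UNIV (\<U> (Suc (2 * n)))" for n
    unfolding e_def by (rule bij_betw_from_nat_into[OF cnt inf])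
  have "\<exists>m. \<forall>m'\<ge>m. x \<in> e n m'" if "x \<in> ?M" for x n
  proof -
    have "finite (e n -` {U \<in> \<U> (Suc (2 * n)). x \<notin> U})"
      using e[of n] by (intro finite_vimageI gam that) (simp add: bij_betw_def)
    moreover have "e n -` {U \<in> \<U> (Suc (2 * n)). x \<notin> U} = {m. x \<notin> e n m}"
      using e[of n] by (auto simp: bij_betw_def)
    ultimately obtain m where "\<forall>m'\<in>{m. x \<notin> e n m}. m' < m"
      by (auto simp: finite_nat_set_iff_bounded)
    then show ?thesis by (metis mem_Collect_eq not_le)
  qed
  then obtain \<psi> where \<psi>: "\<And>x n m. x \<in> ?M \<Longrightarrow> \<psi> x n \<le> m \<Longrightarrow> x \<in> e n m"
    by metis
  \<comment> \<open>Not being dominated by \<open>\<psi> x\<close> means that \<open>g\<close>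
    exceeds it somewhere, and one such place suffices to cover \<open>x\<close>.\<close>
  have "small (\<psi> ` emb ` E)"
    using E(1) by (intro small_image)
  then obtain g where g: "\<And>c. c \<in> \<psi> ` emb ` E \<Longrightarrow> \<not> g \<le>\<^sup>* c"
    by (rule small_not_dominating) blast
  have in_e: "\<exists>n. emb f \<in> e n (g n)" if "f \<in> R \<inter> E" for f
  proof -
    have "\<not> g \<le>\<^sup>* \<psi> (emb f)" using g that by blast
    then obtain n where "\<psi> (emb f) n \<le> g n"
      unfolding le_star_def eventually_sequentially by (meson nat_le_linear)
    then show ?thesis using \<psi>[of "emb f"] that by blast
  qed
  define U where "U k = (if even k then V (k div 2) else e (k div 2) (g (k div 2)))" for k
  have U_in: "U k \<in> \<U> k" for k
  proof (cases "even k")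
    case True
    then show ?thesis using V(1)[of "k div 2"] by (simp add: U_def)
  next
    case False
    then show ?thesis
      using bij_betwE[OF e[of "k div 2"], rule_format, of "g (k div 2)"] by (simp add: U_def)
  qed
  have U_V: "U (2 * n) = V n" and U_e: "U (Suc (2 * n)) = e n (g n)" for n
    by (simp_all add: U_def)
  have "?M \<subseteq> \<Union>(range U)"
  proof
    fix x assume "x \<in> ?M"
    then consider "x \<in> Q" | f where "f \<in> R - E" "x = emb f" | f where "f \<in> R \<inter> E" "x = emb f"
      by blast
    then show "x \<in> \<Union>(range U)"
    proof cases
      case 1
      then obtain n where "x = q n" using range_q by blast
      then have "x \<in> U (2 * n)" using V(2) U_V by simp
      then show ?thesis by blast
    next
      case 2
      then obtain n where "x \<in> T n" using in_W by blast
      then have "x \<in> U (2 * n)" using T(2) U_V \<open>x \<in> ?M\<close> by simp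
      then show ?thesis by blast
    next
      case 3
      then obtain n where "x \<in> U (Suc (2 * n))" using in_e U_e by blast
      then show ?thesis by blast
    qed
  qed
  moreover have "\<Union>(range U) \<subseteq> ?M"
    using U_in cov by blast
  ultimately have "{U n |n. True} \<in> open_covers (top_of_set ?M)"
    using opn[OF U_in] unfolding open_covers_def by (auto simp: full_SetCompr_eq)
  then show "\<exists>U. (\<forall>n. U n \<in> \<U> n) \<and> {U n |n. True} \<in> open_covers (top_of_set ?M)"
    using U_in by blast
qed

text \<open>The cover with index \<open>n\<close> consists of the sets where coordinate
  \<open>n\<close> is at most \<open>m\<close>. Finite selections bound each coordinate, and a
  member of \<open>R\<close> above all these bounds escapes them.\<close>

lemma not_U_fin_gamma_open:
  assumes dom: "\<forall>g. \<exists>f\<in>R. \<forall>n. g n \<le> f n"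
  shows "\<not> U_fin gamma_covers open_covers (top_of_set (emb ` R))"
proof
  assume U_fin: "U_fin gamma_covers open_covers (top_of_set (emb ` R))"
  define A where "A n m = {x \<in> emb ` R. x n \<le> enat m}" for n m
  have avoid: "emb f \<notin> \<Union>(A n ` I)" if "finite I" "Suc (\<Sum>I) \<le> f n" for I n f
  proof
    assume "emb f \<in> \<Union>(A n ` I)"
    then obtain m where "m \<in> I" "f n \<le> m"
      unfolding A_def emb_def by auto
    moreover have "m \<le> \<Sum>I" using \<open>m \<in> I\<close> that(1) member_le_sum[of m I "\<lambda>x. x"] by simp
    ultimately show False using that(2) by simp
  qed
  have no_finite: "\<not> emb ` R \<subseteq> \<Union>\<F>" if "finite \<F>" "\<F> \<subseteq> range (A n)" for \<F> n
  proof -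
    obtain I where I: "finite I" "\<F> = A n ` I"
      using finite_subset_image[OF \<open>finite \<F>\<close> \<open>\<F> \<subseteq> range (A n)\<close>] by blast
    obtain f where "f \<in> R" "\<forall>k. Suc (\<Sum>I) \<le> f k"
      using dom[rule_format, of "\<lambda>_. Suc (\<Sum>I)"] by blast
    then show ?thesis using avoid[OF I(1)] I(2) by blast
  qed
  have cover: "range (A n) \<in> gamma_covers (top_of_set (emb ` R))" for n
  proof -
    have opn: "openin (top_of_set (emb ` R)) (A n m)" for m
    proof -
      \<comment> \<open>On finite values the bound \<open>m\<close> is the strict bound
        \<open>Suc m\<close>, which gives an open set.\<close>
      have "open {x :: nat \<Rightarrow> enat. x n < enat (Suc m)}"
        by (intro open_Collect_less continuous_on_product_coordinates continuous_on_const)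
      moreover have "A n m = emb ` R \<inter> {x. x n < enat (Suc m)}"
        unfolding A_def emb_def by auto
      ultimately show ?thesis by (auto simp: openin_open)
    qed
    have fin: "finite {U \<in> range (A n). x \<notin> U}" if x: "x \<in> emb ` R" for x
    proof -
      obtain f where f: "x = emb f" using x by blast
      have "m < f n" if "x \<notin> A n m" for m
        using that x f unfolding A_def by (simp add: emb_def)
      then have "{U \<in> range (A n). x \<notin> U} \<subseteq> A n ` {..<f n}"
        by blast
      then show ?thesis by (rule finite_subset) simp
    qed
    have un: "\<Union>(range (A n)) = emb ` R"
      unfolding A_def emb_def by auto
    then have "infinite (range (A n))"
      using no_finite[of "range (A n)" n] by blast
    moreover have "\<not> emb ` R \<subseteq> U" if "U \<in> range (A n)" for U
      using no_finite[of "{U}" n] that by simp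
    ultimately show ?thesis
      using opn fin un unfolding gamma_covers_def open_covers_def by auto
  qed
  have "\<forall>n. range (A n) \<in> gamma_covers (top_of_set (emb ` R)) \<and>
      (\<nexists>\<F>. finite \<F> \<and> \<F> \<subseteq> range (A n) \<and> topspace (top_of_set (emb ` R)) \<subseteq> \<Union>\<F>)"
    using cover no_finite by simp
  then have "\<exists>\<F>. (\<forall>n. finite (\<F> n) \<and> \<F> n \<subseteq> range (A n)) \<and>
      {\<Union>(\<F> n) |n. True} \<in> open_covers (top_of_set (emb ` R))"
    by (rule U_fin[unfolded U_fin_def, THEN spec, THEN mp])
  then obtain \<F> where \<F>: "\<And>n. finite (\<F> n)" "\<And>n. \<F> n \<subseteq> range (A n)"
    "{\<Union>(\<F> n) |n. True} \<in> open_covers (top_of_set (emb ` R))"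
    by blast
  have "\<exists>I. finite I \<and> \<F> n = A n ` I" for n
    using finite_subset_image[OF \<F>(1,2)] by blast
  then obtain I where I: "\<And>n. finite (I n)" "\<And>n. \<F> n = A n ` I n" by metis
  obtain f where f: "f \<in> R" "\<And>n. Suc (\<Sum>(I n)) \<le> f n"
    using dom[rule_format, of "\<lambda>n. Suc (\<Sum>(I n))"] by blast
  have "emb f \<in> \<Union>{\<Union>(\<F> n) |n. True}"
    using \<F>(3) f(1) unfolding open_covers_def by simp
  then obtain n where "emb f \<in> \<Union>(A n ` I n)"
    unfolding I(2) by blast
  then show False
    using avoid[of "I n" f n] I(1) f(2) by blast
qed

text \<open>A \<gamma>-cover is an \<omega>-cover, as a finite set is missed by only finitely many
  of its infinitely many members. The unions of the selected sets stay proper because no cover has a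
  finite subcover.\<close>

lemma U_fin_gamma_omega_if_S_fin_omega_omega:
  assumes "S_fin omega_covers omega_covers X"
  shows "U_fin gamma_covers omega_covers X"
  unfolding U_fin_def
proof (intro allI impI)
  fix \<U> :: "nat \<Rightarrow> 'a set set"
  assume \<U>: "\<forall>n. \<U> n \<in> gamma_covers X \<and> (\<nexists>\<F>. finite \<F> \<and> \<F> \<subseteq> \<U> n \<and> topspace X \<subseteq> \<Union>\<F>)"
  have "\<U> n \<in> omega_covers X" for n
  proof -
    have g: "\<U> n \<in> gamma_covers X" using \<U> by blast
    have "\<exists>U\<in>\<U> n. F \<subseteq> U" if "F \<subseteq> topspace X" "finite F" for F
    proof -
      have "finite (\<Union>x\<in>F. {U \<in> \<U> n. x \<notin> U})"
        using g that unfolding gamma_covers_def by blast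
      moreover have "infinite (\<U> n)"
        using g unfolding gamma_covers_def by blast
      ultimately have "infinite (\<U> n - (\<Union>x\<in>F. {U \<in> \<U> n. x \<notin> U}))"
        by (rule Diff_infinite_finite)
      then obtain U where "U \<in> \<U> n - (\<Union>x\<in>F. {U \<in> \<U> n. x \<notin> U})"
        by (metis ex_in_conv infinite_imp_nonempty)
      then show ?thesis by blast
    qed
    then show ?thesis
      using g unfolding gamma_covers_def omega_covers_def by blast
  qed
  then obtain \<F> where \<F>: "\<And>n. finite (\<F> n)" "\<And>n. \<F> n \<subseteq> \<U> n" "(\<Union>n. \<F> n) \<in> omega_covers X"
    using assms[unfolded S_fin_def, rule_format, of \<U>] by blast
  have opn: "openin X (\<Union>(\<F> n))" for n
    using \<F>(2)[of n] \<U> unfolding gamma_covers_def open_covers_def by blast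
  have fin: "\<exists>U\<in>{\<Union>(\<F> n) |n. True}. F \<subseteq> U" if F: "F \<subseteq> topspace X" "finite F" for F
  proof -
    obtain n U where "U \<in> \<F> n" "F \<subseteq> U"
      using \<F>(3) F unfolding omega_covers_def by blast
    then have "F \<subseteq> \<Union>(\<F> n)" by blast
    then show ?thesis by blast
  qed
  have "\<Union>{\<Union>(\<F> n) |n. True} = \<Union>(\<Union>n. \<F> n)"
    by auto
  also have "\<dots> = topspace X"
    using \<F>(3) unfolding omega_covers_def open_covers_def by simp
  finally have "\<Union>{\<Union>(\<F> n) |n. True} = topspace X" .
  moreover have "countable {\<Union>(\<F> n) |n. True}"
    by (simp add: full_SetCompr_eq)
  moreover have "\<not> topspace X \<subseteq> \<Union>(\<F> n)" for n
    using \<U>[rule_format, of n] \<F>(1,2)[of n] by blast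
  ultimately have "{\<Union>(\<F> n) |n. True} \<in> omega_covers X"
    using opn fin unfolding omega_covers_def open_covers_def by auto
  then show "\<exists>\<F>. (\<forall>n. finite (\<F> n) \<and> \<F> n \<subseteq> \<U> n) \<and> {\<Union>(\<F> n) |n. True} \<in> omega_covers X"
    using \<F>(1,2) by (intro exI[of _ \<F>]) simp
qed

section \<open>Failure of \<sigma>-compactness\<close>

lemma card_of_nat_fun_le_bool_fun: "|UNIV :: (nat \<Rightarrow> nat) set| \<le>o |UNIV :: (nat \<Rightarrow> bool) set|"
proof (rule card_of_ordLeqI)
  let ?g = "\<lambda>(f :: nat \<Rightarrow> nat) k. f (fst (prod_decode k)) = snd (prod_decode k)"
  show "inj_on ?g UNIV"
  proof (rule injI)
    fix f f' assume eq: "?g f = ?g f'"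
    have "f' i = f i" for i
      using fun_cong[OF eq, of "prod_encode (i, f i)"] by simp
    then show "f = f'" by auto
  qed
qed simp

lemma compact_imp_closed_enat_fun:
  fixes C :: "(nat \<Rightarrow> enat) set"
  assumes "compact C"
  shows "closed C"
proof -
  have "Hausdorff_space (euclidean :: enat topology)"
    unfolding Hausdorff_space_def using hausdorff by (auto simp: disjnt_def)
  then have "Hausdorff_space (product_topology (\<lambda>i::nat. euclidean :: enat topology) UNIV)"
    by (simp add: Hausdorff_space_product_topology)
  then have "closedin (product_topology (\<lambda>i::nat. euclidean :: enat topology) UNIV) C"
    by (rule compactin_imp_closedin) (simp add: euclidean_product_topology assms)
  then show ?thesis by (simp add: euclidean_product_topology)
qed

text \<open>A Cantor scheme in the Baire space: \<open>lim\<close> expresses closedness there. Each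
  binary branch converges inside \<open>A\<close>, and its coordinate \<open>i\<close> depends only
  on the first \<open>Suc i\<close> bits, so it takes finitely many values.\<close>

lemma uncountable_closed_contains_bounded_continuum:
  fixes A :: "(nat \<Rightarrow> nat) set"
  assumes unc: "uncountable A"
    and lim: "\<forall>F b. (\<forall>k. F k \<in> A) \<longrightarrow> (\<forall>i. \<forall>\<^sub>F k in sequentially. F k i = b i) \<longrightarrow> b \<in> A"
  obtains \<beta> :: "(nat \<Rightarrow> bool) \<Rightarrow> nat \<Rightarrow> nat" and g where "inj \<beta>" "range \<beta> \<subseteq> A" "\<And>x i. \<beta> x i \<le> g i"
proof -
  define cyl where "cyl s = {f \<in> A. map f [0..<length s] = s}" for s
  \<comment> \<open>The points all of whose cylinders are uncountable; only countably many points
    are lost, and near each remaining point there is another one.\<close>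
  define A' where "A' = {f \<in> A. \<forall>n. uncountable (cyl (map f [0..<n]))}"
  have "A - A' \<subseteq> (\<Union>s\<in>{s. countable (cyl s)}. cyl s)"
  proof
    fix f assume "f \<in> A - A'"
    then obtain n where "f \<in> A" "countable (cyl (map f [0..<n]))" unfolding A'_def by blast
    moreover have "f \<in> cyl (map f [0..<n])" using \<open>f \<in> A\<close> unfolding cyl_def by simp
    ultimately show "f \<in> (\<Union>s\<in>{s. countable (cyl s)}. cyl s)" by blast
  qed
  moreover have "countable (\<Union>s\<in>{s. countable (cyl s)}. cyl s)"
    by (intro countable_UN) auto
  ultimately have cnt: "countable (A - A')" by (rule countable_subset)
  have "\<not> A \<subseteq> A - A'" using unc cnt countable_subset by blast
  then obtain f0 where f0: "f0 \<in> A'" by blast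
  have "\<exists>f'. f' \<in> A' \<and> f' \<noteq> f \<and> (\<forall>i<n. f' i = f i)" if "f \<in> A'" for f n
  proof -
    have "uncountable (cyl (map f [0..<n]))" using that unfolding A'_def by blast
    moreover have "countable ((A - A') \<union> {f})" using cnt by simp
    ultimately have "\<not> cyl (map f [0..<n]) \<subseteq> (A - A') \<union> {f}" using countable_subset by blast
    then obtain f' where f': "f' \<in> cyl (map f [0..<n])" "f' \<in> A'" "f' \<noteq> f"
      unfolding cyl_def by blast
    then have "map f' [0..<n] = map f [0..<n]" unfolding cyl_def by simp
    then have "\<forall>i<n. f' i = f i" by (simp add: map_eq_conv)
    then show ?thesis using f' by blast
  qed
  then obtain sp where sp: "\<And>f n. f \<in> A' \<Longrightarrow> sp f n \<in> A'" "\<And>f n. f \<in> A' \<Longrightarrow> sp f n \<noteq> f"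
      "\<And>f n i. f \<in> A' \<Longrightarrow> i < n \<Longrightarrow> sp f n i = f i"
    by metis
  define d where "d f n = (LEAST i. sp f n i \<noteq> f i)" for f n
  have d: "sp f n (d f n) \<noteq> f (d f n)" if "f \<in> A'" for f n
  proof -
    have "\<exists>i. sp f n i \<noteq> f i" using sp(2)[OF that] by blast
    then show ?thesis unfolding d_def by (rule LeastI_ex)
  qed
  have d_ge: "n \<le> d f n" if "f \<in> A'" for f n
    using d[OF that, of n] sp(3)[OF that, of "d f n" n] by (meson not_le)
  \<comment> \<open>A node holds a point of \<open>A'\<close> and the length already fixed. The bit
    decides whether to keep the point or to replace it by a nearby one, and the new length just
    includes their first difference.\<close>
  define nxt where "nxt b p = (if b then sp (fst p) (snd p) else fst p, Suc (d (fst p) (snd p)))"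
    for b and p :: "(nat \<Rightarrow> nat) \<times> nat"
  define node where "node x k = rec_nat (f0, 0) (\<lambda>k. nxt (x k)) k" for x :: "nat \<Rightarrow> bool" and k
  define F where "F x k = fst (node x k)" for x k
  define N where "N x k = snd (node x k)" for x k
  have node_Suc: "node x (Suc k) = nxt (x k) (node x k)" for x k
    unfolding node_def by simp
  have F_Suc: "F x (Suc k) = (if x k then sp (F x k) (N x k) else F x k)"
    and N_Suc: "N x (Suc k) = Suc (d (F x k) (N x k))" for x k
    unfolding F_def N_def node_Suc nxt_def by simp_all
  have F_A': "F x k \<in> A'" for x k
  proof (induction k)
    case 0
    then show ?case using f0 by (simp add: F_def node_def)
  next
    case (Suc k)
    then show ?case using sp(1) by (simp add: F_Suc)
  qed
  have N_less: "N x k < N x (Suc k)" for x k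
    using d_ge[OF F_A'[of x k], of "N x k"] unfolding N_Suc by simp
  have N_ge: "k \<le> N x k" for x k
  proof (induction k)
    case (Suc k)
    then show ?case using N_less[of x k] by simp
  qed simp
  have agree_Suc: "F x (Suc k) i = F x k i" if "i < N x k" for x k i
    using that sp(3)[OF F_A'] unfolding F_Suc by simp
  have agree: "F x (k + j) i = F x k i" if "i < N x k" for x k i j
  proof (induction j)
    case (Suc j)
    have "N x k \<le> N x (k + j)"
      by (rule lift_Suc_mono_le[of "N x"]) (simp_all add: less_imp_le[OF N_less])
    then show ?case using agree_Suc[of i x "k + j"] Suc that by simp
  qed simp
  \<comment> \<open>At stage \<open>Suc i\<close> more than \<open>i\<close> coordinates are fixed,
    so coordinate \<open>i\<close> is final.\<close>
  define \<beta> where "\<beta> x i = F x (Suc i) i" for x i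
  have \<beta>_eq: "\<beta> x i = F x k i" if "i < N x k" for x k i
  proof (cases "k \<le> Suc i")
    case True
    then show ?thesis using agree[OF that, of "Suc i - k"] unfolding \<beta>_def by simp
  next
    case False
    have "i < N x (Suc i)" using N_ge[of "Suc i" x] by simp
    then show ?thesis using agree[of i x "Suc i" "k - Suc i"] False unfolding \<beta>_def by simp
  qed
  have "\<beta> x \<in> A" for x
  proof (rule lim[rule_format])
    show "F x k \<in> A" for k using F_A' unfolding A'_def by blast
    have "F x k i = \<beta> x i" if "k \<ge> Suc i" for k i
      using \<beta>_eq[of i x k] N_ge[of k x] that by simp
    then show "\<forall>\<^sub>F k in sequentially. F x k i = \<beta> x i" for i
      unfolding eventually_sequentially by blast
  qed
  moreover have "inj \<beta>"
  proof (rule injI, rule ccontr)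
    fix x y assume eq: "\<beta> x = \<beta> y" and "x \<noteq> y"
    define k where "k = (LEAST k. x k \<noteq> y k)"
    have "\<exists>k. x k \<noteq> y k" using \<open>x \<noteq> y\<close> by blast
    then have k: "x k \<noteq> y k" unfolding k_def by (rule LeastI_ex)
    have before: "x j = y j" if "j < k" for j
      using not_less_Least[of j "\<lambda>k. x k \<noteq> y k"] that unfolding k_def by blast
    have "node x j = node y j" if "j \<le> k" for j
      using that
    proof (induction j)
      case (Suc j)
      then show ?case using before[of j] by (simp add: node_Suc)
    qed (simp add: node_def)
    then have same: "F x k = F y k" "N x k = N y k" unfolding F_def N_def by simp_all
    let ?i = "d (F x k) (N x k)"
    have "F x (Suc k) ?i = F y (Suc k) ?i"
      using \<beta>_eq[of ?i x "Suc k"] \<beta>_eq[of ?i y "Suc k"] eq same by (simp add: N_Suc)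
    then show False
      using d[OF F_A'[of x k], of "N x k"] k same by (cases "x k") (simp_all add: F_Suc)
  qed
  moreover have "\<beta> x i \<le> Max (range (\<lambda>x. \<beta> x i))" for x i
  proof -
    have fin: "finite (range (\<lambda>x. node x k))" for k
    proof (induction k)
      case (Suc k)
      have "range (\<lambda>x. node x (Suc k)) \<subseteq> (\<Union>b. nxt b ` range (\<lambda>x. node x k))"
        unfolding node_Suc by blast
      moreover have "finite (\<Union>b. nxt b ` range (\<lambda>x. node x k))"
        using Suc by simp
      ultimately show ?case by (rule finite_subset)
    qed (simp add: node_def)
    have "range (\<lambda>x. \<beta> x i) = (\<lambda>p. fst p i) ` range (\<lambda>x. node x (Suc i))"
      unfolding \<beta>_def F_def by auto
    then have "finite (range (\<lambda>x. \<beta> x i))" using fin by simp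
    then show ?thesis by (rule Max_ge) simp
  qed
  ultimately show ?thesis using that[of \<beta> "\<lambda>i. Max (range (\<lambda>x. \<beta> x i))"] by blast
qed

lemma dominating_number_le_everywhere_dominating:
  fixes R :: "(nat \<Rightarrow> nat) set"
  assumes "\<forall>g. \<exists>f\<in>R. \<forall>n. g n \<le> f n"
  shows "dominating_number \<le>o |R|"
proof (rule dominating_number_le)
  fix g :: "nat \<Rightarrow> nat"
  obtain f where "f \<in> R" "\<forall>n. g n \<le> f n" using assms by blast
  then show "\<exists>f\<in>R. g \<le>\<^sup>* f" by (auto simp: le_star_def intro!: bexI[of _ f])
qed

text \<open>Some compact piece would contain uncountably many sequences from \<open>R\<close>, hence
  a bounded continuum of them. Bounded sequences have no gaps for a suitable \<open>H\<close>, so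
  they are all exceptional, but a small set cannot contain a continuum.\<close>

lemma not_sigma_compact:
  assumes R: "\<forall>f\<in>R. strict_mono f" and dom: "\<forall>g. \<exists>f\<in>R. \<forall>n. g n \<le> f n"
    and conc: "\<forall>H. \<exists>E. small E \<and> (\<forall>f\<in>R - E. gap f H \<noteq> {})"
  shows "\<not> sigma_compact (Q \<union> emb ` R)"
proof
  assume "sigma_compact (Q \<union> emb ` R)"
  then obtain \<K> where \<K>: "countable \<K>" "\<forall>C\<in>\<K>. compact C" "\<Union>\<K> = Q \<union> emb ` R"
    unfolding sigma_compact_def by metis
  have "\<not> small R"
    using not_ordLess_ordLeq[of "card_of R" dominating_number] dominating_number_le_everywhere_dominating[OF dom]
    unfolding small_def by blast
  then have unc: "uncountable R"
    using countable_imp_small by blast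
  have "R \<subseteq> (\<Union>C\<in>\<K>. emb -` C)"
    using \<K>(3) by blast
  then have "uncountable (\<Union>C\<in>\<K>. emb -` C)"
    using unc countable_subset by blast
  then obtain C where C: "C \<in> \<K>" "uncountable (emb -` C)"
    using \<K>(1) countable_UN[of \<K> "\<lambda>C. emb -` C"] by blast
  have sub: "emb -` C \<subseteq> R"
  proof
    fix f assume "f \<in> emb -` C"
    then have "emb f \<in> Q \<union> emb ` R" using \<K>(3) C(1) by blast
    then show "f \<in> R" using emb_not_in_Q inj_emb by (auto dest: injD)
  qed
  have "closed C" using \<K>(2) C(1) by (intro compact_imp_closed_enat_fun) blast
  have "\<forall>F b. (\<forall>k. F k \<in> emb -` C) \<longrightarrow> (\<forall>i. \<forall>\<^sub>F k in sequentially. F k i = b i) \<longrightarrow> b \<in> emb -` C"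
  proof (intro allI impI)
    fix F b assume F: "\<forall>k. F k \<in> emb -` C" "\<forall>i. \<forall>\<^sub>F k in sequentially. F k i = b i"
    have "((\<lambda>k. emb (F k) i) \<longlongrightarrow> emb b i) sequentially" for i
      using F(2)[rule_format, of i] by (intro tendsto_eventually) (auto simp: emb_def elim: eventually_mono)
    then have "limitin (product_topology (\<lambda>i. euclidean) UNIV) (\<lambda>k. emb (F k)) (emb b) sequentially"
      by (simp add: limitin_componentwise)
    then have "(\<lambda>k. emb (F k)) \<longlonglongrightarrow> emb b"
      by (simp add: euclidean_product_topology)
    then have "emb b \<in> C"
      using closed_sequentially[OF \<open>closed C\<close>, of "\<lambda>k. emb (F k)"] F(1) by simp
    then show "b \<in> emb -` C" by simp
  qed
  from uncountable_closed_contains_bounded_continuum[OF C(2) this]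
  obtain \<beta> :: "(nat \<Rightarrow> bool) \<Rightarrow> nat \<Rightarrow> nat" and g
    where \<beta>: "inj \<beta>" "range \<beta> \<subseteq> emb -` C" "\<And>x i. \<beta> x i \<le> g i"
    by blast
  \<comment> \<open>The index is \<open>Suc n\<close> because a strictly increasing sequence exceeds
    \<open>n\<close> there; its value, at most \<open>g (Suc n)\<close>, lies in the interval that a
    gap at \<open>n\<close> would leave empty.\<close>
  obtain E where E: "small E" "\<And>f. f \<in> R - E \<Longrightarrow> gap f (\<lambda>n. g (Suc n)) \<noteq> {}"
    using conc by blast
  have "\<beta> x \<in> E" for x
  proof (rule ccontr)
    assume "\<beta> x \<notin> E"
    moreover have "\<beta> x \<in> R" using \<beta>(2) sub by blast
    ultimately obtain n where n: "n \<in> gap (\<beta> x) (\<lambda>n. g (Suc n))" using E(2) by blast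
    have "n < \<beta> x (Suc n)"
      using strict_mono_imp_increasing[of "\<beta> x" "Suc n"] R \<open>\<beta> x \<in> R\<close> by simp
    then have "\<beta> x (Suc n) \<in> range (\<beta> x) \<inter> {n<..g (Suc n)}"
      using \<beta>(3)[of x "Suc n"] by simp
    moreover have "range (\<beta> x) \<inter> {n<..g (Suc n)} = {}"
      using n unfolding gap_def by simp
    ultimately show False by (metis empty_iff)
  qed
  then have "small (range \<beta>)" by (intro small_subset[OF E(1)]) auto
  moreover have "dominating_number \<le>o |range \<beta>|"
  proof -
    obtain D where "dominating_number = |D|" by (rule dominating_family_exists)
    then have "dominating_number \<le>o |UNIV :: (nat \<Rightarrow> nat) set|"
      by (metis card_of_mono1 subset_UNIV)
    moreover have "|UNIV :: (nat \<Rightarrow> bool) set| \<le>o |range \<beta>|"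
      using \<beta>(1) by (intro card_of_ordLeqI[of \<beta>]) auto
    ultimately show ?thesis
      using card_of_nat_fun_le_bool_fun by (meson ordLeq_transitive)
  qed
  ultimately show False
    unfolding small_def using not_ordLess_ordLeq by blast
qed

section \<open>Finite selections from \<omega>-covers\<close>

text \<open>Otherwise every step would add a point to the trace on \<open>F\<close>, whose size is
  at most \<open>card F\<close>.\<close>

lemma increasing_sets_stabilise_on_finite:
  assumes "finite F" "\<And>k. E k \<subseteq> E (Suc k)"
  shows "\<exists>k::nat. F \<inter> E (Suc k) \<subseteq> E k"
proof (rule ccontr)
  assume "\<not> ?thesis"
  then have psub: "F \<inter> E k \<subset> F \<inter> E (Suc k)" for k
    using assms(2) by blast
  have "k \<le> card (F \<inter> E k)" for k
  proof (induction k)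
    case (Suc k)
    have "card (F \<inter> E k) < card (F \<inter> E (Suc k))"
      using psub assms(1) by (intro psubset_card_mono) auto
    then show ?case using Suc by simp
  qed simp
  from this[of "Suc (card F)"] show False
    using card_mono[OF assms(1), of "F \<inter> E (Suc (card F))"] by simp
qed

text \<open>The required gaps \<open>N F\<close> depend on a finite set \<open>F\<close> of exceptional sequences, while the set of
  exceptions depends on the gaps. The sets \<open>E k\<close> iterate this dependence \<open>\<omega>\<close> times; a finite set of
  sequences meets two consecutive \<open>E k\<close> in the same part, and that part is taken as \<open>F\<close>.\<close>

lemma S_fin_omega_omega:
  assumes U: "cofinal_ultrafilter U" and R: "\<forall>f\<in>R. strict_mono f"
    and conc: "\<forall>H. \<exists>E. small E \<and> (\<forall>f\<in>R - E. eventually (\<lambda>n. n \<in> gap f H) U)"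
  shows "S_fin omega_covers omega_covers (top_of_set (Q \<union> emb ` R))"
  unfolding S_fin_def
proof (intro allI impI)
  fix \<U> :: "nat \<Rightarrow> (nat \<Rightarrow> enat) set set"
  let ?M = "Q \<union> emb ` R"
  assume \<U>: "\<forall>n. \<U> n \<in> omega_covers (top_of_set ?M)"
  have cnt: "countable (\<U> n)" and opn: "V \<in> \<U> n \<Longrightarrow> openin (top_of_set ?M) V"
    and omg: "F \<subseteq> ?M \<Longrightarrow> finite F \<Longrightarrow> \<exists>V\<in>\<U> n. F \<subseteq> V"
    and proper: "V \<in> \<U> n \<Longrightarrow> \<not> ?M \<subseteq> V" for n V F
    using \<U>[rule_format, of n] unfolding omega_covers_def open_covers_def by simp_all
  have bounded: "\<exists>g. \<forall>c\<in>C. eventually (\<lambda>n. c n \<le> g n) U" if "small C" for C :: "(nat \<Rightarrow> nat) set"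
    using U that unfolding cofinal_ultrafilter_def by blast
  define K where "K n = q_seq ` Pow {..n}" for n :: nat
  have K: "finite (K n)" "K n \<subseteq> Q" for n
    unfolding K_def Q_def using finite_subset by (simp, blast)
  \<comment> \<open>A member containing \<open>K n\<close> also contains each sequence of
    \<open>R\<close> with a long enough gap at \<open>n\<close>; the sequences of \<open>F\<close>
    are put in outright.\<close>
  have "\<exists>V. V \<in> \<U> n \<and> emb ` F \<union> K n \<subseteq> V" if "finite F" "F \<subseteq> R" for F n
    using omg[of "emb ` F \<union> K n" n] that K[of n] by blast
  then obtain V where V: "\<And>F n. finite F \<Longrightarrow> F \<subseteq> R \<Longrightarrow> V F n \<in> \<U> n"
      "\<And>F n. finite F \<Longrightarrow> F \<subseteq> R \<Longrightarrow> emb ` F \<union> K n \<subseteq> V F n"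
    by metis
  have "\<exists>N. \<forall>f\<in>R. range f \<inter> {n<..N} = {} \<longrightarrow> emb f \<in> V F n" if F: "finite F" "F \<subseteq> R" for F n
  proof -
    obtain T where T: "open T" "V F n = ?M \<inter> T"
      using opn[OF V(1)[OF F]] by (auto simp: openin_open)
    have "q_seq s \<in> T" if "s \<subseteq> {..n}" for s
      using V(2)[OF F, of n] T(2) that unfolding K_def by blast
    from gap_neighbourhood[OF T(1) this] obtain N
      where "\<And>f. strict_mono f \<Longrightarrow> range f \<inter> {n<..N} = {} \<Longrightarrow> emb f \<in> T" by blast
    then show ?thesis using R T(2) by blast
  qed
  then obtain N where N: "\<And>F n f. finite F \<Longrightarrow> F \<subseteq> R \<Longrightarrow> f \<in> R \<Longrightarrow> range f \<inter> {n<..N F n} = {} \<Longrightarrow> emb f \<in> V F n"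
    by metis
  \<comment> \<open>With the members of a cover numbered, a finite selection can consist of all
    those numbered up to \<open>J n\<close>.\<close>
  define j where "j F n = to_nat_on (\<U> n) (V F n)" for F n
  have j: "from_nat_into (\<U> n) (j F n) = V F n" if "finite F" "F \<subseteq> R" for F n
    unfolding j_def using cnt V(1)[OF that] by simp
  \<comment> \<open>A small \<open>E\<close> has a small family of finite subsets, so a single
    function bounds all their gap thresholds modulo \<open>U\<close>; the numbers \<open>j\<close>
    are treated likewise.\<close>
  have "\<exists>H. \<forall>F\<in>Fpow (E \<inter> R). eventually (\<lambda>n. N F n \<le> H n) U" if "small E" for E
    using bounded[OF small_image[OF small_Fpow[OF small_subset[OF that]]], of "E \<inter> R" N] by simp
  then obtain HH where HH: "\<And>E F. small E \<Longrightarrow> F \<in> Fpow (E \<inter> R) \<Longrightarrow> eventually (\<lambda>n. N F n \<le> HH E n) U"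
    by metis
  have "\<exists>J. \<forall>F\<in>Fpow (E \<inter> R). eventually (\<lambda>n. j F n \<le> J n) U" if "small E" for E
    using bounded[OF small_image[OF small_Fpow[OF small_subset[OF that]]], of "E \<inter> R" j] by simp
  then obtain JJ where JJ: "\<And>E F. small E \<Longrightarrow> F \<in> Fpow (E \<inter> R) \<Longrightarrow> eventually (\<lambda>n. j F n \<le> JJ E n) U"
    by metis
  obtain EE where EE: "\<And>H. small (EE H)" "\<And>H f. f \<in> R - EE H \<Longrightarrow> eventually (\<lambda>n. n \<in> gap f H) U"
    using conc by metis
  define E where "E = rec_nat {} (\<lambda>_ A. A \<union> EE (HH A))"
  have E_Suc: "E (Suc k) = E k \<union> EE (HH (E k))" for k
    unfolding E_def by simp
  have E_small: "small (E k)" for k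
  proof (induction k)
    case 0
    then show ?case by (simp add: E_def countable_imp_small)
  next
    case (Suc k)
    then show ?case unfolding E_Suc using EE(1) by (rule small_Un)
  qed
  have "small (range (\<lambda>k. JJ (E k)))"
    by (rule countable_imp_small) simp
  then obtain J where J: "\<And>k. eventually (\<lambda>n. JJ (E k) n \<le> J n) U"
    using bounded[of "range (\<lambda>k. JJ (E k))"] by blast
  define \<F> where "\<F> n = from_nat_into (\<U> n) ` {..J n}" for n
  have \<F>: "finite (\<F> n)" "\<F> n \<subseteq> \<U> n" for n
  proof -
    \<comment> \<open>On a nonempty set \<open>from_nat_into\<close> takes values only in that set,
      also at numbers beyond a finite enumeration.\<close>
    have "\<U> n \<noteq> {}" using omg[of "{}" n] by auto
    then show "finite (\<F> n)" "\<F> n \<subseteq> \<U> n"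
      unfolding \<F>_def by (auto intro: from_nat_into)
  qed
  have omega: "\<exists>V\<in>(\<Union>n. \<F> n). G \<subseteq> V" if G: "G \<subseteq> ?M" "finite G" for G
  proof -
    define F where "F = {f \<in> R. emb f \<in> G}"
    have F: "finite F" "F \<subseteq> R"
      using finite_vimageI[OF G(2) inj_emb] unfolding F_def vimage_def by auto
    have "\<exists>n. x \<in> K n" if "x \<in> Q" for x
    proof -
      obtain s where s: "finite s" "x = q_seq s" using \<open>x \<in> Q\<close> unfolding Q_def by blast
      then obtain n where "s \<subseteq> {..n}" using finite_nat_iff_bounded_le by blast
      then show ?thesis using s(2) unfolding K_def by blast
    qed
    then obtain \<nu> where \<nu>: "\<And>x. x \<in> Q \<Longrightarrow> x \<in> K (\<nu> x)" by metis
    have K_mono: "K m \<subseteq> K n" if "m \<le> n" for m n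
      unfolding K_def using that by (intro image_mono Pow_mono) auto
    define n0 where "n0 = (\<Sum>x\<in>G. \<nu> x)"
    have Q_K: "G \<inter> Q \<subseteq> K n" if "n \<ge> n0" for n
    proof
      fix x assume "x \<in> G \<inter> Q"
      then have "\<nu> x \<le> n0" unfolding n0_def using G(2) by (intro member_le_sum) auto
      then show "x \<in> K n" using \<nu> \<open>x \<in> G \<inter> Q\<close> K_mono[of "\<nu> x" n] that by auto
    qed
    \<comment> \<open>A sequence of \<open>F\<close> outside \<open>E k\<close> is then also outside
      \<open>E (Suc k)\<close>, and so has gaps for \<open>HH (E k)\<close> at \<open>U\<close>-many
      arguments.\<close>
    obtain k where k: "F \<inter> E (Suc k) \<subseteq> E k"
      using increasing_sets_stabilise_on_finite[OF F(1), of E] E_Suc by blast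
    let ?F = "F \<inter> E k"
    have F': "finite ?F" "?F \<subseteq> R" "?F \<in> Fpow (E k \<inter> R)"
      using F unfolding Fpow_def by auto
    have "eventually (\<lambda>n. \<forall>f\<in>F - E k. n \<in> gap f (HH (E k))) U"
      using F k E_Suc by (intro eventually_ball_finite ballI EE(2)) auto
    moreover have "eventually (\<lambda>n. n \<ge> n0) U"
      using U eventually_ge_at_top filter_leD unfolding cofinal_ultrafilter_def by blast
    moreover note HH[OF E_small F'(3)] JJ[OF E_small F'(3)] J[of k]
    ultimately have "eventually (\<lambda>n. (\<forall>f\<in>F - E k. n \<in> gap f (HH (E k))) \<and> n \<ge> n0 \<and>
        N ?F n \<le> HH (E k) n \<and> j ?F n \<le> J n) U"
      by eventually_elim auto
    moreover have "U \<noteq> bot" using U unfolding cofinal_ultrafilter_def ultrafilter_def by blast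
    ultimately obtain n where n: "\<forall>f\<in>F - E k. n \<in> gap f (HH (E k))" "n \<ge> n0"
        "N ?F n \<le> HH (E k) n" "j ?F n \<le> J n"
      using eventually_happens[of _ U] by blast
    have "emb f \<in> V ?F n" if "f \<in> F" for f
    proof (cases "f \<in> E k")
      case True
      then show ?thesis using V(2)[OF F'(1,2)] that by blast
    next
      case False
      then have "n \<in> gap f (N ?F)"
        using n(1) that gap_antimono[of "N ?F" n "HH (E k)" f, OF n(3)] by blast
      then show ?thesis
        using N[OF F'(1,2)] that F(2) unfolding gap_def by blast
    qed
    then have "G \<subseteq> V ?F n"
      using G(1) Q_K[OF n(2)] V(2)[OF F'(1,2), of n] unfolding F_def by blast
    moreover have "V ?F n \<in> \<F> n"
      using j[OF F'(1,2), of n] n(4) unfolding \<F>_def by (metis atMost_iff image_eqI)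
    ultimately show ?thesis by blast
  qed
  have "x \<in> \<Union>(\<Union>n. \<F> n)" if "x \<in> ?M" for x
    using omega[of "{x}"] that by blast
  moreover have "openin (top_of_set ?M) V" "\<not> ?M \<subseteq> V" if "V \<in> (\<Union>n. \<F> n)" for V
    using that opn proper \<F>(2) by blast+
  moreover from this(1) have "\<Union>(\<Union>n. \<F> n) \<subseteq> ?M"
    using openin_subset by fastforce
  moreover have "countable (\<Union>n. \<F> n)"
    using \<F>(1) by (intro countable_UN) (auto intro: countable_finite)
  ultimately have "(\<Union>n. \<F> n) \<in> omega_covers (top_of_set ?M)"
    using omega unfolding omega_covers_def open_covers_def by auto
  then show "\<exists>\<F>. (\<forall>n. finite (\<F> n) \<and> \<F> n \<subseteq> \<U> n) \<and> (\<Union>n. \<F> n) \<in> omega_covers (top_of_set ?M)"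
    using \<F> by (intro exI[of _ \<F>]) simp
qed

text \<open>Gathers the conclusions common to both cases of the final split, for which a single gap
  per nonexceptional sequence is enough.\<close>

lemma gap_set_properties:
  assumes card: "|R| \<le>o dominating_number" and R: "\<forall>f\<in>R. strict_mono f"
    and dom: "\<forall>g. \<exists>f\<in>R. \<forall>n. g n \<le> f n"
    and conc: "\<forall>H. \<exists>E. small E \<and> (\<forall>f\<in>R - E. gap f H \<noteq> {})"
  shows "Q \<union> emb ` R \<subseteq> incr_space" "\<not> sigma_compact (Q \<union> emb ` R)"
    "|Q \<union> emb ` R| =o dominating_number"
    "S_1 gamma_covers open_covers (top_of_set (Q \<union> emb ` R))"
    "\<not> U_fin gamma_covers open_covers (top_of_set (Q \<union> emb ` R - Q))"
proof -
  show "Q \<union> emb ` R \<subseteq> incr_space"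
    using Q_subset_incr_space emb_in_incr_space R by blast
  show "\<not> sigma_compact (Q \<union> emb ` R)"
    by (rule not_sigma_compact[OF R dom conc])
  show "S_1 gamma_covers open_covers (top_of_set (Q \<union> emb ` R))"
    by (rule S_1_gamma_open[OF R conc])
  have "Q \<union> emb ` R - Q = emb ` R"
    using emb_not_in_Q by blast
  then show "\<not> U_fin gamma_covers open_covers (top_of_set (Q \<union> emb ` R - Q))"
    using not_U_fin_gamma_open[OF dom] by simp
  have "|Q| \<le>o dominating_number"
    using countable_imp_small[OF countable_Q] ordLess_imp_ordLeq unfolding small_def by blast
  moreover have "|emb ` R| \<le>o dominating_number"
    using card_of_image[of emb R] card by (rule ordLeq_transitive)
  ultimately have "|Q \<union> emb ` R| \<le>o dominating_number"
    by (rule Un_Cinfinite_bound[OF _ _ Cinfinite_dominating_number])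
  moreover have "|R| \<le>o |Q \<union> emb ` R|"
    by (rule card_of_ordLeqI[of emb]) (auto intro: inj_on_subset[OF inj_emb])
  ultimately show "|Q \<union> emb ` R| =o dominating_number"
    using dominating_number_le_everywhere_dominating[OF dom] by (meson ordIso_iff_ordLeq ordLeq_transitive)
qed

text \<open>The choice of \<open>M\<close> depends on whether a cofinal ultrafilter exists. If one
  does, \<open>M\<close> has all the covering properties claimed; if none does, the hypotheses of
  the conditional claims fail and single gaps suffice.\<close>

theorem theorem4p9:
  shows "\<exists>M \<subseteq> incr_space. \<not> sigma_compact M \<and>
    |M| =o dominating_number \<and>
    (S_1 gamma_covers open_covers (top_of_set M) \<and>
      \<not> U_fin gamma_covers open_covers (top_of_set (M - Q))) \<and>
    (NCF \<longrightarrow> U_fin gamma_covers omega_covers (top_of_set M)) \<and>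
    (bounding_number =o dominating_number \<or> additivity D_fin =o dominating_number \<longrightarrow>
      S_fin omega_covers omega_covers (top_of_set M))"
proof (cases "\<exists>U. cofinal_ultrafilter U")
  case True
  then obtain U where U: "cofinal_ultrafilter U" by blast
  obtain R where R: "|R| \<le>o dominating_number" "\<forall>f\<in>R. strict_mono f" "\<forall>g. \<exists>f\<in>R. \<forall>n. g n \<le> f n"
    and conc: "\<forall>H. \<exists>E. small E \<and> (\<forall>f\<in>R - E. eventually (\<lambda>n. n \<in> gap f H) U)"
    by (rule ultrafilter_gap_family[OF U])
  have "U \<noteq> bot" using U unfolding cofinal_ultrafilter_def ultrafilter_def by blast
  then have "gap f H \<noteq> {}" if "eventually (\<lambda>n. n \<in> gap f H) U" for f H
    using that by auto
  then have "\<forall>H. \<exists>E. small E \<and> (\<forall>f\<in>R - E. gap f H \<noteq> {})"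
    using conc by meson
  note props = gap_set_properties[OF R this]
  have S_fin: "S_fin omega_covers omega_covers (top_of_set (Q \<union> emb ` R))"
    by (rule S_fin_omega_omega[OF U R(2) conc])
  then have "U_fin gamma_covers omega_covers (top_of_set (Q \<union> emb ` R))"
    by (rule U_fin_gamma_omega_if_S_fin_omega_omega)
  then show ?thesis
    using props S_fin by (intro exI[of _ "Q \<union> emb ` R"]) simp
next
  case False
  then have "\<not> NCF" "\<not> bounding_number =o dominating_number" "\<not> additivity D_fin =o dominating_number"
    using cofinal_ultrafilter_if_NCF cofinal_ultrafilter_if_bounding_eq_dominating
      cofinal_ultrafilter_if_additivity_eq_dominating by blast+
  moreover obtain R where R: "|R| \<le>o dominating_number" "\<forall>f\<in>R. strict_mono f"
      "\<forall>g. \<exists>f\<in>R. \<forall>n. g n \<le> f n" "\<forall>H. \<exists>E. small E \<and> (\<forall>f\<in>R - E. gap f H \<noteq> {})"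
    by (rule gap_family)
  ultimately show ?thesis
    using gap_set_properties[OF R] by (intro exI[of _ "Q \<union> emb ` R"]) simp
qed

end
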